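(* For every infinite binary sequence $X$ and every $c$, the theory $\mathsf{MLR}'_c(X)$ is a conservative extension of $\mathsf{MLR}''_c(X)$: every arithmetical formula not containing the symbol $f$ that is provable in $\mathsf{MLR}'_c(X)$ is provable in $\mathsf{MLR}''_c(X)$ (and conversely).
   Context: $\mathsf{PA}$ is Peano arithmetic; $\mathrm{K}$ is prefix Kolmogorov complexity, represented in $\mathsf{PA}$ naturally. Let $X=x_0x_1x_2\ldots$ and $X\upharpoonright n=x_0\ldots x_{n-1}$. $\mathsf{MLR}'_c(X)$ is the theory in the language of $\mathsf{PA}$ extended by a unary function symbol $f$, consisting of the axioms of $\mathsf{PA}$ with the induction scheme extended to formulas containing $f$, one axiom stating that $f$ takes values in $\{0,1\}$ and that for every $n$ the string $f(0)f(1)\ldots f(n-1)$ has prefix complexity $\mathrm{K}\ge n-c$, and the axioms $f(\bar i)=\bar x_i$ for all $i$. For a string $u$, $\mathsf{Ext}_c(u)$ is the arithmetical statement: for every $n\ge|u|$ there is a string $v$ of length $n$ extending $u$ such that every prefix $w$ of $v$ satisfies $\mathrm{K}(w)\ge|w|-c$. $\mathsf{MLR}''_c(X)$ is $\mathsf{PA}$ plus the axioms $\mathsf{Ext}_c(X\upharpoonright n)$ for all $n$. *)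

theory Defs
  imports Main "HOL-Library.Extended_Nat" "HOL-Library.Sublist"
begin

section \<open>First-order arithmetic with one extra unary function symbol\<close>

text \<open>
  Formulas use de Bruijn indices: index 0 refers to the innermost quantifier, and indices that
  exceed the number of enclosing quantifiers are free variables. \<open>Fn\<close> is the additional function
  symbol \<open>f\<close>; terms and formulas without it form the language of PA.
\<close>

datatype tm =
    Var nat
  | Zero
  | Succ tm
  | Add tm tm (infixl \<open>\<^bold>+\<close> 65)
  | Mul tm tm (infixl \<open>\<^bold>*\<close> 70)
  | Fn tm

datatype fm =
    Bot (\<open>\<^bold>\<bottom>\<close>)
  | Eql tm tm (infix \<open>\<^bold>=\<close> 50)
  | Imp fm fm (infixr \<open>\<^bold>\<longrightarrow>\<close> 25)
  | Forall fm (\<open>\<^bold>\<forall>_\<close> [20] 20)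

abbreviation Neg :: "fm \<Rightarrow> fm" (\<open>\<^bold>\<not>_\<close> [40] 40) where
  "\<^bold>\<not>\<phi> \<equiv> \<phi> \<^bold>\<longrightarrow> \<^bold>\<bottom>"
abbreviation Conj :: "fm \<Rightarrow> fm \<Rightarrow> fm" (infixr \<open>\<^bold>\<and>\<close> 35) where
  "\<phi> \<^bold>\<and> \<psi> \<equiv> \<^bold>\<not>(\<phi> \<^bold>\<longrightarrow> \<^bold>\<not>\<psi>)"
abbreviation Disj :: "fm \<Rightarrow> fm \<Rightarrow> fm" (infixr \<open>\<^bold>\<or>\<close> 30) where
  "\<phi> \<^bold>\<or> \<psi> \<equiv> \<^bold>\<not>\<phi> \<^bold>\<longrightarrow> \<psi>"
abbreviation Exists :: "fm \<Rightarrow> fm" (\<open>\<^bold>\<exists>_\<close> [20] 20) where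
  "\<^bold>\<exists>\<phi> \<equiv> \<^bold>\<not>(\<^bold>\<forall>\<^bold>\<not>\<phi>)"

primrec tsubst :: "(nat \<Rightarrow> tm) \<Rightarrow> tm \<Rightarrow> tm" where
  "tsubst \<sigma> (Var i) = \<sigma> i"
| "tsubst \<sigma> Zero = Zero"
| "tsubst \<sigma> (Succ t) = Succ (tsubst \<sigma> t)"
| "tsubst \<sigma> (s \<^bold>+ t) = tsubst \<sigma> s \<^bold>+ tsubst \<sigma> t"
| "tsubst \<sigma> (s \<^bold>* t) = tsubst \<sigma> s \<^bold>* tsubst \<sigma> t"
| "tsubst \<sigma> (Fn t) = Fn (tsubst \<sigma> t)"

definition lift :: "nat \<Rightarrow> tm \<Rightarrow> tm" where
  "lift k = tsubst (\<lambda>i. Var (i + k))"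

primrec subst :: "(nat \<Rightarrow> tm) \<Rightarrow> fm \<Rightarrow> fm" where
  "subst \<sigma> \<^bold>\<bottom> = \<^bold>\<bottom>"
| "subst \<sigma> (s \<^bold>= t) = (tsubst \<sigma> s \<^bold>= tsubst \<sigma> t)"
| "subst \<sigma> (\<phi> \<^bold>\<longrightarrow> \<psi>) = (subst \<sigma> \<phi> \<^bold>\<longrightarrow> subst \<sigma> \<psi>)"
| "subst \<sigma> (\<^bold>\<forall>\<phi>) = (\<^bold>\<forall>subst (case_nat (Var 0) (\<lambda>i. lift 1 (\<sigma> i))) \<phi>)"

text \<open>\<open>inst \<phi> t\<close> is the result of removing the quantifier of \<open>\<^bold>\<forall>\<phi>\<close> and putting \<open>t\<close> for its variable.\<close>

definition inst :: "fm \<Rightarrow> tm \<Rightarrow> fm" where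
  "inst \<phi> t = subst (case_nat t Var) \<phi>"

primrec arith_tm :: "tm \<Rightarrow> bool" where
  "arith_tm (Var i) = True"
| "arith_tm Zero = True"
| "arith_tm (Succ t) = arith_tm t"
| "arith_tm (s \<^bold>+ t) = (arith_tm s \<and> arith_tm t)"
| "arith_tm (s \<^bold>* t) = (arith_tm s \<and> arith_tm t)"
| "arith_tm (Fn t) = False"

primrec arithmetical :: "fm \<Rightarrow> bool" where
  "arithmetical \<^bold>\<bottom> = True"
| "arithmetical (s \<^bold>= t) = (arith_tm s \<and> arith_tm t)"
| "arithmetical (\<phi> \<^bold>\<longrightarrow> \<psi>) = (arithmetical \<phi> \<and> arithmetical \<psi>)"
| "arithmetical (\<^bold>\<forall>\<phi>) = arithmetical \<phi>"

definition L_PA :: "fm set" where "L_PA = {\<phi>. arithmetical \<phi>}"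
definition L_PA_f :: "fm set" where "L_PA_f = UNIV"

primrec tm_vars :: "tm \<Rightarrow> nat set" where
  "tm_vars (Var i) = {i}"
| "tm_vars Zero = {}"
| "tm_vars (Succ t) = tm_vars t"
| "tm_vars (s \<^bold>+ t) = tm_vars s \<union> tm_vars t"
| "tm_vars (s \<^bold>* t) = tm_vars s \<union> tm_vars t"
| "tm_vars (Fn t) = tm_vars t"

primrec free_vars :: "fm \<Rightarrow> nat set" where
  "free_vars \<^bold>\<bottom> = {}"
| "free_vars (s \<^bold>= t) = tm_vars s \<union> tm_vars t"
| "free_vars (\<phi> \<^bold>\<longrightarrow> \<psi>) = free_vars \<phi> \<union> free_vars \<psi>"
| "free_vars (\<^bold>\<forall>\<phi>) = {i. Suc i \<in> free_vars \<phi>}"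


section \<open>Provability\<close>

inductive logical_axiom :: "fm \<Rightarrow> bool" where
  "logical_axiom (\<phi> \<^bold>\<longrightarrow> \<psi> \<^bold>\<longrightarrow> \<phi>)"
| "logical_axiom ((\<phi> \<^bold>\<longrightarrow> \<psi> \<^bold>\<longrightarrow> \<chi>) \<^bold>\<longrightarrow> (\<phi> \<^bold>\<longrightarrow> \<psi>) \<^bold>\<longrightarrow> \<phi> \<^bold>\<longrightarrow> \<chi>)"
| "logical_axiom (\<^bold>\<not>\<^bold>\<not>\<phi> \<^bold>\<longrightarrow> \<phi>)"
| "logical_axiom ((\<^bold>\<forall>\<phi>) \<^bold>\<longrightarrow> inst \<phi> t)"
| "logical_axiom ((\<^bold>\<forall>(\<phi> \<^bold>\<longrightarrow> \<psi>)) \<^bold>\<longrightarrow> (\<^bold>\<forall>\<phi>) \<^bold>\<longrightarrow> (\<^bold>\<forall>\<psi>))"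
| "logical_axiom (\<phi> \<^bold>\<longrightarrow> (\<^bold>\<forall>subst (\<lambda>i. Var (Suc i)) \<phi>))"
| "logical_axiom (t \<^bold>= t)"
| "logical_axiom (s \<^bold>= t \<^bold>\<longrightarrow> inst \<phi> s \<^bold>\<longrightarrow> inst \<phi> t)"

text \<open>
  \<open>provable L T \<phi>\<close>: there is a Hilbert-style derivation of \<open>\<phi>\<close> from \<open>T\<close> in which only formulas of
  the language \<open>L\<close> occur. Non-logical axioms with free variables are read as their universal
  closures, which is why generalisation is unrestricted.
\<close>

inductive provable :: "fm set \<Rightarrow> fm set \<Rightarrow> fm \<Rightarrow> bool" for L T where
  logical: "logical_axiom \<phi> \<Longrightarrow> \<phi> \<in> L \<Longrightarrow> provable L T \<phi>"
| axiom: "\<phi> \<in> T \<Longrightarrow> \<phi> \<in> L \<Longrightarrow> provable L T \<phi>"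
| modus_ponens: "provable L T (\<phi> \<^bold>\<longrightarrow> \<psi>) \<Longrightarrow> provable L T \<phi> \<Longrightarrow> provable L T \<psi>"
| generalisation: "provable L T \<phi> \<Longrightarrow> (\<^bold>\<forall>\<phi>) \<in> L \<Longrightarrow> provable L T (\<^bold>\<forall>\<phi>)"


section \<open>Peano arithmetic\<close>

definition induction_axiom :: "fm \<Rightarrow> fm" where
  "induction_axiom \<phi> =
    (inst \<phi> Zero \<^bold>\<longrightarrow>
     (\<^bold>\<forall>(\<phi> \<^bold>\<longrightarrow> subst (case_nat (Succ (Var 0)) (\<lambda>i. Var (Suc i))) \<phi>)) \<^bold>\<longrightarrow>
     (\<^bold>\<forall>\<phi>))"

text \<open>The axioms of PA with the induction scheme for all formulas of \<open>L\<close>.\<close>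

definition PA_over :: "fm set \<Rightarrow> fm set" where
  "PA_over L =
    {\<^bold>\<not>(Succ (Var 0) \<^bold>= Zero),
     Succ (Var 0) \<^bold>= Succ (Var 1) \<^bold>\<longrightarrow> Var 0 \<^bold>= Var 1,
     Var 0 \<^bold>+ Zero \<^bold>= Var 0,
     Var 0 \<^bold>+ Succ (Var 1) \<^bold>= Succ (Var 0 \<^bold>+ Var 1),
     Var 0 \<^bold>* Zero \<^bold>= Zero,
     Var 0 \<^bold>* Succ (Var 1) \<^bold>= Var 0 \<^bold>* Var 1 \<^bold>+ Var 0}
    \<union> induction_axiom ` L"

definition PA :: "fm set" where "PA = PA_over L_PA"

primrec num :: "nat \<Rightarrow> tm" where
  "num 0 = Zero"
| "num (Suc n) = Succ (num n)"

text \<open>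
  Truth in the standard model, meant for formulas of the language of PA only (the symbol \<open>f\<close> has no
  standard interpretation).
\<close>

primrec tm_val :: "(nat \<Rightarrow> nat) \<Rightarrow> tm \<Rightarrow> nat" where
  "tm_val e (Var i) = e i"
| "tm_val e Zero = 0"
| "tm_val e (Succ t) = Suc (tm_val e t)"
| "tm_val e (s \<^bold>+ t) = tm_val e s + tm_val e t"
| "tm_val e (s \<^bold>* t) = tm_val e s * tm_val e t"
| "tm_val e (Fn t) = undefined"

primrec true_in_N :: "(nat \<Rightarrow> nat) \<Rightarrow> fm \<Rightarrow> bool" where
  "true_in_N e \<^bold>\<bottom> = False"
| "true_in_N e (s \<^bold>= t) = (tm_val e s = tm_val e t)"
| "true_in_N e (\<phi> \<^bold>\<longrightarrow> \<psi>) = (true_in_N e \<phi> \<longrightarrow> true_in_N e \<psi>)"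
| "true_in_N e (\<^bold>\<forall>\<phi>) = (\<forall>x. true_in_N (case_nat x e) \<phi>)"

definition Le :: "tm \<Rightarrow> tm \<Rightarrow> fm" (infix \<open>\<^bold>\<le>\<close> 50) where
  "s \<^bold>\<le> t = (\<^bold>\<exists>(lift 1 s \<^bold>+ Var 0 \<^bold>= lift 1 t))"

definition Less :: "tm \<Rightarrow> tm \<Rightarrow> fm" (infix \<open>\<^bold><\<close> 50) where
  "s \<^bold>< t = (Succ s \<^bold>\<le> t)"

inductive delta0 :: "fm \<Rightarrow> bool" where
  "delta0 \<^bold>\<bottom>"
| "delta0 (s \<^bold>= t)"
| "delta0 \<phi> \<Longrightarrow> delta0 \<psi> \<Longrightarrow> delta0 (\<phi> \<^bold>\<longrightarrow> \<psi>)"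
| "delta0 \<phi> \<Longrightarrow> delta0 (\<^bold>\<forall>(Var 0 \<^bold>\<le> lift 1 t \<^bold>\<longrightarrow> \<phi>))"

inductive sigma1 :: "fm \<Rightarrow> bool" where
  "delta0 \<phi> \<Longrightarrow> sigma1 \<phi>"
| "sigma1 \<phi> \<Longrightarrow> sigma1 (\<^bold>\<exists>\<phi>)"


section \<open>Binary strings in arithmetic\<close>

text \<open>
  The string \<open>w\<close> is coded by the number with binary expansion \<open>1w\<close>; the strings thus correspond
  exactly to the positive numbers.
\<close>

definition code :: "bool list \<Rightarrow> nat" where
  "code w = foldl (\<lambda>a b. 2 * a + of_bool b) 1 w"

text \<open>Goedel's beta function: \<open>y = a mod (1 + (i + 1) b)\<close>.\<close>

definition Beta :: "tm \<Rightarrow> tm \<Rightarrow> tm \<Rightarrow> tm \<Rightarrow> fm" where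
  "Beta a b i y =
    (let m = Succ (Succ i \<^bold>* b)
     in y \<^bold>< m \<^bold>\<and> (\<^bold>\<exists>(lift 1 a \<^bold>= Var 0 \<^bold>* lift 1 m \<^bold>+ lift 1 y)))"

text \<open>\<open>P = 2\<^sup>k\<close>: some beta-coded sequence starts with 1, doubles \<open>k\<close> times and then is \<open>P\<close>.\<close>

definition Exp2 :: "tm \<Rightarrow> tm \<Rightarrow> fm" where
  "Exp2 k P =
    (\<^bold>\<exists>\<^bold>\<exists>(Beta (Var 1) (Var 0) Zero (num 1)
       \<^bold>\<and> (\<^bold>\<forall>(Var 0 \<^bold>< lift 3 k \<^bold>\<longrightarrow>
             (\<^bold>\<exists>(Beta (Var 3) (Var 2) (Var 1) (Var 0)
                \<^bold>\<and> Beta (Var 3) (Var 2) (Succ (Var 1)) (Var 0 \<^bold>+ Var 0)))))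
       \<^bold>\<and> Beta (Var 1) (Var 0) (lift 2 k) (lift 2 P)))"

definition Str :: "tm \<Rightarrow> fm" where
  "Str s = (\<^bold>\<not>(s \<^bold>= Zero))"

text \<open>\<open>s\<close> codes a string of length \<open>n\<close>, i.e. \<open>2\<^sup>n \<le> s < 2\<^sup>n + 2\<^sup>n\<close>.\<close>

definition Len :: "tm \<Rightarrow> tm \<Rightarrow> fm" where
  "Len s n =
    (\<^bold>\<exists>(Exp2 (lift 1 n) (Var 0) \<^bold>\<and> Var 0 \<^bold>\<le> lift 1 s \<^bold>\<and> lift 1 s \<^bold>< Var 0 \<^bold>+ Var 0))"

text \<open>\<open>u\<close> is a prefix of \<open>v\<close>, i.e. \<open>v = u \<cdot> 2\<^sup>k + r\<close> for some \<open>k\<close> and \<open>r < 2\<^sup>k\<close>.\<close>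

definition Prefix :: "tm \<Rightarrow> tm \<Rightarrow> fm" where
  "Prefix u v =
    (Str u \<^bold>\<and>
     (\<^bold>\<exists>\<^bold>\<exists>\<^bold>\<exists>(Exp2 (Var 2) (Var 1) \<^bold>\<and> Var 0 \<^bold>< Var 1
             \<^bold>\<and> lift 3 v \<^bold>= lift 3 u \<^bold>* Var 1 \<^bold>+ Var 0)))"


section \<open>Prefix Kolmogorov complexity\<close>

datatype recf =
    RZero
  | RSucc
  | RProj nat
  | RComp recf "recf list"
  | RPrim recf recf
  | RMin recf

text \<open>\<open>reval r xs y\<close>: the partial recursive function \<open>r\<close> is defined on \<open>xs\<close> and has the value \<open>y\<close>.\<close>

inductive reval :: "recf \<Rightarrow> nat list \<Rightarrow> nat \<Rightarrow> bool" where
  "reval RZero xs 0"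
| "reval RSucc [x] (Suc x)"
| "i < length xs \<Longrightarrow> reval (RProj i) xs (xs ! i)"
| "list_all2 (\<lambda>g y. reval g xs y) gs ys \<Longrightarrow> reval h ys z \<Longrightarrow> reval (RComp h gs) xs z"
| "reval g xs y \<Longrightarrow> reval (RPrim g h) (0 # xs) y"
| "reval (RPrim g h) (n # xs) r \<Longrightarrow> reval h (n # r # xs) y \<Longrightarrow> reval (RPrim g h) (Suc n # xs) y"
| "reval g (n # xs) 0 \<Longrightarrow> (\<forall>m<n. \<exists>y. reval g (m # xs) (Suc y)) \<Longrightarrow> reval (RMin g) xs n"

definition prefix_machine :: "(bool list \<Rightarrow> bool list option) \<Rightarrow> bool" where
  "prefix_machine M \<longleftrightarrow>
    (\<exists>r. \<forall>x y. reval r [x] y \<longleftrightarrow> (\<exists>p w. x = code p \<and> y = code w \<and> M p = Some w)) \<and>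
    (\<forall>p\<in>dom M. \<forall>q\<in>dom M. prefix p q \<longrightarrow> p = q)"

definition complexity :: "(bool list \<Rightarrow> bool list option) \<Rightarrow> bool list \<Rightarrow> enat" where
  "complexity M w = (INF p\<in>{p. M p = Some w}. enat (length p))"

definition optimal_prefix_machine :: "(bool list \<Rightarrow> bool list option) \<Rightarrow> bool" where
  "optimal_prefix_machine M \<longleftrightarrow>
    prefix_machine M \<and>
    (\<forall>M'. prefix_machine M' \<longrightarrow> (\<exists>d::nat. \<forall>w. complexity M w \<le> complexity M' w + enat d))"

text \<open>\<open>app2 U p w\<close>: the formula \<open>U\<close>, with \<open>p\<close> and \<open>w\<close> put for its free variables 0 and 1.\<close>

definition app2 :: "fm \<Rightarrow> tm \<Rightarrow> tm \<Rightarrow> fm" where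
  "app2 U p w = subst (\<lambda>i. if i = 0 then p else w) U"

text \<open>The sentence saying that \<open>U\<close> is the graph of a function on strings with prefix-free domain.\<close>

definition Prefix_machine :: "fm \<Rightarrow> fm" where
  "Prefix_machine U =
    ((\<^bold>\<forall>\<^bold>\<forall>(app2 U (Var 1) (Var 0) \<^bold>\<longrightarrow> Str (Var 1) \<^bold>\<and> Str (Var 0)))
     \<^bold>\<and> (\<^bold>\<forall>\<^bold>\<forall>\<^bold>\<forall>(app2 U (Var 2) (Var 1) \<^bold>\<longrightarrow> app2 U (Var 2) (Var 0) \<^bold>\<longrightarrow> Var 1 \<^bold>= Var 0))
     \<^bold>\<and> (\<^bold>\<forall>\<^bold>\<forall>\<^bold>\<forall>\<^bold>\<forall>(app2 U (Var 3) (Var 1) \<^bold>\<longrightarrow> app2 U (Var 2) (Var 0) \<^bold>\<longrightarrow>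
                 Prefix (Var 3) (Var 2) \<^bold>\<longrightarrow> Var 3 \<^bold>= Var 2)))"

definition sigma1_machine :: "fm \<Rightarrow> bool" where
  "sigma1_machine U \<longleftrightarrow>
    arithmetical U \<and> free_vars U \<subseteq> {0, 1} \<and> sigma1 U \<and> provable L_PA PA (Prefix_machine U)"

text \<open>The sentence saying that every \<open>M\<close>-program of length \<open>k\<close> can be replaced by a
  \<open>U\<close>-program of length at most \<open>k + d\<close>.\<close>

definition Simulates :: "fm \<Rightarrow> fm \<Rightarrow> nat \<Rightarrow> fm" where
  "Simulates U M d =
    (\<^bold>\<forall>\<^bold>\<forall>\<^bold>\<forall>(app2 M (Var 2) (Var 1) \<^bold>\<longrightarrow> Len (Var 2) (Var 0) \<^bold>\<longrightarrow>
       (\<^bold>\<exists>\<^bold>\<exists>(app2 U (Var 1) (Var 3) \<^bold>\<and> Len (Var 1) (Var 0) \<^bold>\<and> Var 0 \<^bold>\<le> Var 2 \<^bold>+ num d))))"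

text \<open>
  Prefix complexity is determined only up to the choice of an optimal machine. A formula \<open>U(p, w)\<close>
  is a natural representation of such a machine if it is a \<open>\<Sigma>\<^sub>1\<close> formula defining its graph in the
  standard model and PA proves that it is a prefix-free machine and that it is optimal.
\<close>

definition natural_representation :: "fm \<Rightarrow> bool" where
  "natural_representation U \<longleftrightarrow>
    sigma1_machine U \<and>
    (\<exists>M. optimal_prefix_machine M \<and>
      (\<forall>x y. true_in_N (\<lambda>_. 0) (app2 U (num x) (num y)) \<longleftrightarrow>
        (\<exists>p w. x = code p \<and> y = code w \<and> M p = Some w))) \<and>
    (\<forall>M. sigma1_machine M \<longrightarrow> (\<exists>d. provable L_PA PA (Simulates U M d)))"

text \<open>\<open>K(w) = k\<close>: the least length of a program for \<open>w\<close> is \<open>k\<close>.\<close>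

definition K_eq :: "fm \<Rightarrow> tm \<Rightarrow> tm \<Rightarrow> fm" where
  "K_eq U w k =
    ((\<^bold>\<exists>(app2 U (Var 0) (lift 1 w) \<^bold>\<and> Len (Var 0) (lift 1 k)))
     \<^bold>\<and> (\<^bold>\<forall>\<^bold>\<forall>(app2 U (Var 1) (lift 2 w) \<^bold>\<longrightarrow> Len (Var 1) (Var 0) \<^bold>\<longrightarrow> lift 2 k \<^bold>\<le> Var 0)))"

text \<open>\<open>K(w) \<ge> n - c\<close>, written without subtraction as \<open>n \<le> K(w) + c\<close>.\<close>

definition K_ge :: "fm \<Rightarrow> nat \<Rightarrow> tm \<Rightarrow> tm \<Rightarrow> fm" where
  "K_ge U c w n = (\<^bold>\<forall>(K_eq U (lift 1 w) (Var 0) \<^bold>\<longrightarrow> lift 1 n \<^bold>\<le> Var 0 \<^bold>+ num c))"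


section \<open>The two theories\<close>

text \<open>
  \<open>s\<close> codes the string \<open>f(0) \<dots> f(n-1)\<close>: it has length \<open>n\<close>, and for every \<open>i < n\<close> some string \<open>q\<close> of
  length \<open>i\<close> followed by the bit \<open>f(i)\<close>, coded by \<open>2q + f(i)\<close>, is a prefix of it.
\<close>

definition F_restrict :: "tm \<Rightarrow> tm \<Rightarrow> fm" where
  "F_restrict n s =
    (Len s n
     \<^bold>\<and> (\<^bold>\<forall>(Var 0 \<^bold>< lift 1 n \<^bold>\<longrightarrow>
            (\<^bold>\<exists>(Len (Var 0) (Var 1) \<^bold>\<and> Prefix (Var 0 \<^bold>+ Var 0 \<^bold>+ Fn (Var 1)) (lift 2 s))))))"

definition random_axiom :: "fm \<Rightarrow> nat \<Rightarrow> fm" where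
  "random_axiom U c =
    ((\<^bold>\<forall>(Fn (Var 0) \<^bold>= Zero \<^bold>\<or> Fn (Var 0) \<^bold>= num 1))
     \<^bold>\<and> (\<^bold>\<forall>\<^bold>\<exists>(F_restrict (Var 1) (Var 0) \<^bold>\<and> K_ge U c (Var 0) (Var 1))))"

definition MLR' :: "fm \<Rightarrow> nat \<Rightarrow> (nat \<Rightarrow> bool) \<Rightarrow> fm set" where
  "MLR' U c X =
    PA_over L_PA_f \<union> {random_axiom U c}
    \<union> {Fn (num i) \<^bold>= num (of_bool (X i)) | i. True}"

definition Ext :: "fm \<Rightarrow> nat \<Rightarrow> bool list \<Rightarrow> fm" where
  "Ext U c u =
    (\<^bold>\<forall>(num (length u) \<^bold>\<le> Var 0 \<^bold>\<longrightarrow>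
       (\<^bold>\<exists>(Len (Var 0) (Var 1) \<^bold>\<and> Prefix (num (code u)) (Var 0) \<^bold>\<and>
          (\<^bold>\<forall>\<^bold>\<forall>(Prefix (Var 1) (Var 2) \<^bold>\<longrightarrow> Len (Var 1) (Var 0) \<^bold>\<longrightarrow> K_ge U c (Var 1) (Var 0)))))))"

definition initial_segment :: "(nat \<Rightarrow> bool) \<Rightarrow> nat \<Rightarrow> bool list" where
  "initial_segment X n = map X [0..<n]"

definition MLR'' :: "fm \<Rightarrow> nat \<Rightarrow> (nat \<Rightarrow> bool) \<Rightarrow> fm set" where
  "MLR'' U c X = PA \<union> {Ext U c (initial_segment X n) | n. True}"

end

theory Submission
  imports Defs "HOL-Library.Countable" "HOL-Library.Countable_Set"
begin

text \<open>
  By soundness and completeness it suffices to compare models.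

  A model of \<open>MLR'\<close> satisfies each \<open>Ext(X|n)\<close>: the required extension of length \<open>m\<close> is the
  restriction of \<open>f\<close> to \<open>m\<close>, and each of its prefixes is again a restriction of \<open>f\<close>.

  Conversely, a proof in \<open>MLR'\<close> uses the axioms \<open>f(i) = x\<^sub>i\<close> only for \<open>i < n\<close>. In a model of
  \<open>Ext(X|n)\<close> call a string good if it has arbitrarily long extensions that also extend \<open>X|n\<close> and
  have only prefixes of complexity deficiency at most \<open>c\<close>. The numerically least good strings of the
  various lengths form an arithmetically definable infinite path (the leftmost one), which serves as
  an interpretation of \<open>f\<close>; induction for formulas with \<open>f\<close> reduces to arithmetical induction.

  Goedel's beta lemma is never needed: both theories postulate strings of all lengths and thereby the
  totality of the function coded by \<open>Exp2\<close>, and uniqueness of its values is a simple induction.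
\<close>

text \<open>The obstacle is induction. A model satisfies it only for definable properties, and
  interpreting \<open>f\<close> by an arbitrary path may destroy it for formulas with
  \<open>f\<close>; a path definable in the model is safe. But a definable path cannot in general
  obey all axioms \<open>f(i) = x_i\<close> at once, since in the standard model it would make X
  arithmetical. Hence a proof is first cut down to finitely many of these axioms, and goodness
  refers to the single string \<open>X|n\<close>; the path may leave X afterwards. That good strings
  can be continued is Koenig's lemma inside the model: one of the two one-bit extensions of a good
  string is good. Taking the least code makes the choice canonical, so the path is definable without
  coding a sequence of choices. It is the leftmost path because codes of strings of equal length are
  ordered lexicographically. Derivations are confined to their language, so a derivation that uses
  \<open>f\<close> cannot be reused for an arithmetical conclusion. Completeness in the language
  without \<open>f\<close> supplies a new one, and it is therefore proved for both
  languages.\<close>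

section \<open>Semantics of the language and soundness\<close>

text \<open>Keeps \<open>Var 1\<close> and \<open>lift 1\<close> from being rewritten to \<open>Var (Suc 0)\<close> and \<open>lift (Suc 0)\<close>.\<close>

declare One_nat_def [simp del]

lemma case_nat_1 [simp]: "case_nat a f 1 = f 0"
  by (simp add: One_nat_def)

text \<open>Both languages share one type of structures. For an arithmetical theory
  \<open>fn_in\<close> is meaningless, and an expansion by \<open>f\<close> is then a mere record
  update.\<close>

record 'a struct =
  zero_in :: 'a
  succ_in :: "'a \<Rightarrow> 'a"
  add_in :: "'a \<Rightarrow> 'a \<Rightarrow> 'a"
  mul_in :: "'a \<Rightarrow> 'a \<Rightarrow> 'a"
  fn_in :: "'a \<Rightarrow> 'a"

primrec tval :: "'a struct \<Rightarrow> (nat \<Rightarrow> 'a) \<Rightarrow> tm \<Rightarrow> 'a" where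
  "tval M e (Var i) = e i"
| "tval M e Zero = zero_in M"
| "tval M e (Succ t) = succ_in M (tval M e t)"
| "tval M e (s \<^bold>+ t) = add_in M (tval M e s) (tval M e t)"
| "tval M e (s \<^bold>* t) = mul_in M (tval M e s) (tval M e t)"
| "tval M e (Fn t) = fn_in M (tval M e t)"

primrec sat :: "'a struct \<Rightarrow> (nat \<Rightarrow> 'a) \<Rightarrow> fm \<Rightarrow> bool" where
  "sat M e \<^bold>\<bottom> = False"
| "sat M e (s \<^bold>= t) = (tval M e s = tval M e t)"
| "sat M e (\<phi> \<^bold>\<longrightarrow> \<psi>) = (sat M e \<phi> \<longrightarrow> sat M e \<psi>)"
| "sat M e (\<^bold>\<forall>\<phi>) = (\<forall>x. sat M (case_nat x e) \<phi>)"

definition models :: "'a struct \<Rightarrow> fm set \<Rightarrow> bool" where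
  "models M T \<longleftrightarrow> (\<forall>\<phi>\<in>T. \<forall>e. sat M e \<phi>)"

lemma tval_tsubst: "tval M e (tsubst \<sigma> t) = tval M (\<lambda>i. tval M e (\<sigma> i)) t"
  by (induction t) simp_all

lemma tval_lift: "tval M e (lift k t) = tval M (\<lambda>i. e (i + k)) t"
  by (simp add: lift_def tval_tsubst)

lemma tval_lift1 [simp]:
  "tval M (case_nat x e) (lift 1 t) = tval M e t"
  by (simp add: tval_lift One_nat_def)

lemma tval_lift2 [simp]: "tval M (case_nat x (case_nat y e)) (lift 2 t) = tval M e t"
  by (simp add: tval_lift)

lemma tval_lift3 [simp]:
  "tval M (case_nat x (case_nat y (case_nat z e))) (lift 3 t) = tval M e t"
  by (simp add: tval_lift numeral_3_eq_3)

lemma sat_subst: "sat M e (subst \<sigma> \<phi>) = sat M (\<lambda>i. tval M e (\<sigma> i)) \<phi>"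
proof (induction \<phi> arbitrary: e \<sigma>)
  case (Forall \<phi>)
  have "(\<lambda>i. tval M (case_nat x e) (case_nat (Var 0) (\<lambda>i. lift 1 (\<sigma> i)) i))
      = case_nat x (\<lambda>i. tval M e (\<sigma> i))" for x
    by (rule ext) (simp split: nat.split)
  then show ?case using Forall by simp
qed (simp_all add: tval_tsubst)

lemma sat_inst: "sat M e (inst \<phi> t) = sat M (case_nat (tval M e t) e) \<phi>"
proof -
  have "(\<lambda>i. tval M e (case_nat t Var i)) = case_nat (tval M e t) e"
    by (rule ext) (simp split: nat.split)
  then show ?thesis by (simp add: inst_def sat_subst)
qed

lemma sat_logical_axiom: "logical_axiom \<phi> \<Longrightarrow> sat M e \<phi>"
  by (induction arbitrary: e rule: logical_axiom.induct) (auto simp: sat_inst sat_subst)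

lemma soundness: "provable L T \<phi> \<Longrightarrow> models M T \<Longrightarrow> sat M e \<phi>"
  by (induction arbitrary: e rule: provable.induct) (auto simp: models_def sat_logical_axiom)

lemma tval_fn_update: "arith_tm t \<Longrightarrow> tval (M\<lparr>fn_in := g\<rparr>) e t = tval M e t"
  by (induction t) simp_all

lemma sat_fn_update: "arithmetical \<phi> \<Longrightarrow> sat (M\<lparr>fn_in := g\<rparr>) e \<phi> = sat M e \<phi>"
  by (induction \<phi> arbitrary: e) (simp_all add: tval_fn_update)

section \<open>Composition and locality of simultaneous substitution\<close>

lemma tsubst_tsubst: "tsubst \<sigma> (tsubst \<tau> t) = tsubst (\<lambda>i. tsubst \<sigma> (\<tau> i)) t"
  by (induction t) simp_all

lemma tsubst_cong: "(\<And>i. i \<in> tm_vars t \<Longrightarrow> \<sigma> i = \<tau> i) \<Longrightarrow> tsubst \<sigma> t = tsubst \<tau> t"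
  by (induction t) simp_all

lemma tsubst_Var [simp]: "tsubst Var t = t"
  by (induction t) simp_all

lemma tsubst_lift: "tsubst \<sigma> (lift k t) = tsubst (\<lambda>i. \<sigma> (i + k)) t"
  by (simp add: lift_def tsubst_tsubst)

lemma tsubst_case_lift1 [simp]: "tsubst (case_nat a \<sigma>) (lift 1 t) = tsubst \<sigma> t"
  by (simp add: tsubst_lift One_nat_def)

lemma lift_tsubst: "lift k (tsubst \<sigma> t) = tsubst (\<lambda>i. lift k (\<sigma> i)) t"
  by (simp add: lift_def tsubst_tsubst)

lemma subst_subst: "subst \<sigma> (subst \<tau> \<phi>) = subst (\<lambda>i. tsubst \<sigma> (\<tau> i)) \<phi>"
proof (induction \<phi> arbitrary: \<sigma> \<tau>)
  case (Forall \<phi>)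
  have "(\<lambda>i. tsubst (case_nat (Var 0) (\<lambda>i. lift 1 (\<sigma> i))) (case_nat (Var 0) (\<lambda>i. lift 1 (\<tau> i)) i))
     = case_nat (Var 0) (\<lambda>i. lift 1 (tsubst \<sigma> (\<tau> i)))"
    by (rule ext) (simp add: lift_tsubst split: nat.split)
  then show ?case using Forall by simp
qed (simp_all add: tsubst_tsubst)

lemma subst_cong: "(\<And>i. i \<in> free_vars \<phi> \<Longrightarrow> \<sigma> i = \<tau> i) \<Longrightarrow> subst \<sigma> \<phi> = subst \<tau> \<phi>"
proof (induction \<phi> arbitrary: \<sigma> \<tau>)
  case (Eql s t)
  then show ?case by (auto intro: tsubst_cong)
next
  case (Forall \<phi>)
  show ?case
    by (simp, rule Forall.IH) (auto simp: Forall.prems split: nat.split)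
next
  case (Imp \<phi> \<psi>)
  have "subst \<sigma> \<phi> = subst \<tau> \<phi>" "subst \<sigma> \<psi> = subst \<tau> \<psi>"
    by (rule Imp.IH, simp add: Imp.prems)+
  then show ?case by simp
qed simp

lemma subst_Var [simp]: "subst Var \<phi> = \<phi>"
proof (induction \<phi>)
  case (Forall \<phi>)
  have "case_nat (Var 0) (\<lambda>i. lift 1 (Var i)) = Var"
    by (rule ext) (simp add: lift_def split: nat.split)
  then show ?case using Forall by simp
qed simp_all

lemma finite_tm_vars [simp]: "finite (tm_vars t)"
  by (induction t) simp_all

lemma finite_free_vars [simp]: "finite (free_vars \<phi>)"
proof (induction \<phi>)
  case (Forall \<phi>)
  have "finite {i. Suc i \<in> free_vars \<phi>}"
    using finite_vimageI[OF Forall, of Suc] by (simp add: vimage_def)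
  then show ?case by simp
qed simp_all

text \<open>Instances of a substituted quantified formula are again substitution instances of its
  body, as the quantifier case of the truth lemma in \<open>term_model\<close> requires.\<close>

lemma inst_subst: "inst (subst (case_nat (Var 0) (\<lambda>i. lift 1 (\<sigma> i))) \<phi>) t = subst (case_nat t \<sigma>) \<phi>"
proof -
  have "(\<lambda>i. tsubst (case_nat t Var) (case_nat (Var 0) (\<lambda>i. lift 1 (\<sigma> i)) i)) = case_nat t \<sigma>"
    by (rule ext) (simp split: nat.split)
  then show ?thesis by (simp add: inst_def subst_subst)
qed

text \<open>The flag selects the language: \<open>lang False\<close> is \<open>L_PA\<close> and
  \<open>lang True\<close> is \<open>L_PA_f\<close>. One completeness proof thus serves
  both.\<close>

definition lang :: "bool \<Rightarrow> fm set" where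
  "lang b = {\<phi>. b \<or> arithmetical \<phi>}"

definition lang_tm :: "bool \<Rightarrow> tm set" where
  "lang_tm b = {t. b \<or> arith_tm t}"

lemma lang_simps [simp]:
  "\<^bold>\<bottom> \<in> lang b"
  "(s \<^bold>= t) \<in> lang b \<longleftrightarrow> s \<in> lang_tm b \<and> t \<in> lang_tm b"
  "(\<phi> \<^bold>\<longrightarrow> \<psi>) \<in> lang b \<longleftrightarrow> \<phi> \<in> lang b \<and> \<psi> \<in> lang b"
  "(\<^bold>\<forall>\<phi>) \<in> lang b \<longleftrightarrow> \<phi> \<in> lang b"
  by (auto simp: lang_def lang_tm_def)

lemma lang_tm_simps [simp]:
  "Var i \<in> lang_tm b"
  "Zero \<in> lang_tm b"
  "Succ t \<in> lang_tm b \<longleftrightarrow> t \<in> lang_tm b"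
  "(s \<^bold>+ t) \<in> lang_tm b \<longleftrightarrow> s \<in> lang_tm b \<and> t \<in> lang_tm b"
  "(s \<^bold>* t) \<in> lang_tm b \<longleftrightarrow> s \<in> lang_tm b \<and> t \<in> lang_tm b"
  "Fn t \<in> lang_tm b \<longleftrightarrow> b"
  by (auto simp: lang_tm_def)

lemma arith_tm_tsubst: "arith_tm t \<Longrightarrow> (\<And>i. arith_tm (\<sigma> i)) \<Longrightarrow> arith_tm (tsubst \<sigma> t)"
  by (induction t) simp_all

lemma arith_tm_lift [simp]: "arith_tm (lift k t) \<longleftrightarrow> arith_tm t"
  by (induction t) (simp_all add: lift_def)

lemma arithmetical_subst: "arithmetical \<phi> \<Longrightarrow> (\<And>i. arith_tm (\<sigma> i)) \<Longrightarrow> arithmetical (subst \<sigma> \<phi>)"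
  by (induction \<phi> arbitrary: \<sigma>) (simp_all add: arith_tm_tsubst split: nat.split)

lemma lang_tm_tsubst: "t \<in> lang_tm b \<Longrightarrow> (\<And>i. \<sigma> i \<in> lang_tm b) \<Longrightarrow> tsubst \<sigma> t \<in> lang_tm b"
  unfolding lang_tm_def using arith_tm_tsubst[of t \<sigma>] by blast

lemma lang_tm_lift [simp]: "lift k t \<in> lang_tm b \<longleftrightarrow> t \<in> lang_tm b"
  by (simp add: lang_tm_def)

lemma lang_subst: "\<phi> \<in> lang b \<Longrightarrow> (\<And>i. \<sigma> i \<in> lang_tm b) \<Longrightarrow> subst \<sigma> \<phi> \<in> lang b"
  unfolding lang_def lang_tm_def using arithmetical_subst[of \<phi> \<sigma>] by blast

lemma lang_inst: "\<phi> \<in> lang b \<Longrightarrow> t \<in> lang_tm b \<Longrightarrow> inst \<phi> t \<in> lang b"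
  unfolding inst_def by (rule lang_subst) (auto split: nat.split)

section \<open>Completeness by Henkin models on the natural numbers\<close>

instance tm :: countable
  by countable_datatype

instance fm :: countable
  by countable_datatype

text \<open>The two successor axioms keep the numerals distinct, so that the term model is infinite
  and can be carried by \<open>nat\<close>.\<close>

locale calculus =
  fixes b :: bool and T :: "fm set"
  assumes T_lang: "T \<subseteq> lang b"
    and T_Succ_nonzero: "(\<^bold>\<not>(Succ (Var 0) \<^bold>= Zero)) \<in> T"
    and T_Succ_inject: "(Succ (Var 0) \<^bold>= Succ (Var 1) \<^bold>\<longrightarrow> Var 0 \<^bold>= Var 1) \<in> T"
begin

abbreviation prov :: "fm \<Rightarrow> bool" where
  "prov \<equiv> provable (lang b) T"

lemma prov_lang: "prov \<phi> \<Longrightarrow> \<phi> \<in> lang b"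
  by (induction rule: provable.induct) simp_all

lemma prov_inst:
  assumes "prov \<phi>" "t \<in> lang_tm b"
  shows "prov (inst \<phi> t)"
proof -
  have \<phi>: "\<phi> \<in> lang b" using assms(1) by (rule prov_lang)
  have "prov (\<^bold>\<forall>\<phi>)" using assms \<phi> by (auto intro: provable.generalisation)
  moreover have "prov ((\<^bold>\<forall>\<phi>) \<^bold>\<longrightarrow> inst \<phi> t)"
    by (rule provable.logical) (auto intro: logical_axiom.intros simp: \<phi> assms lang_inst)
  ultimately show ?thesis by (rule provable.modus_ponens[rotated])
qed

text \<open>Simultaneous substitution is obtained by generalising and instantiating one variable after
  the other; the terms still to be shifted down are lifted in advance.\<close>

lemma prov_subst_below:
  "prov \<phi> \<Longrightarrow> (\<And>i. \<sigma> i \<in> lang_tm b) \<Longrightarrow>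
    prov (subst (\<lambda>i. if i < n then \<sigma> i else Var (i - n)) \<phi>)"
proof (induction n arbitrary: \<sigma>)
  case 0
  then show ?case by simp
next
  case (Suc n)
  let ?\<tau> = "\<lambda>i. if i < n then lift 1 (\<sigma> i) else Var (i - n)"
  have "prov (subst ?\<tau> \<phi>)"
    using Suc.IH[of "\<lambda>i. lift 1 (\<sigma> i)"] Suc.prems by simp
  then have "prov (inst (subst ?\<tau> \<phi>) (\<sigma> n))"
    using Suc.prems by (intro prov_inst)
  also have "inst (subst ?\<tau> \<phi>) (\<sigma> n) = subst (\<lambda>i. if i < Suc n then \<sigma> i else Var (i - Suc n)) \<phi>"
    unfolding inst_def subst_subst
    by (rule arg_cong[of _ _ "\<lambda>\<sigma>. subst \<sigma> \<phi>"]) (auto simp: fun_eq_iff not_less less_Suc_eq split: nat.split)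
  finally show ?case .
qed

lemma prov_subst:
  assumes "prov \<phi>" "\<And>i. \<sigma> i \<in> lang_tm b"
  shows "prov (subst \<sigma> \<phi>)"
proof -
  obtain n where n: "\<forall>i\<in>free_vars \<phi>. i < n"
    using finite_nat_set_iff_bounded[THEN iffD1, OF finite_free_vars] by blast
  have "prov (subst (\<lambda>i. if i < n then \<sigma> i else Var (i - n)) \<phi>)"
    using assms by (rule prov_subst_below)
  also have "subst (\<lambda>i. if i < n then \<sigma> i else Var (i - n)) \<phi> = subst \<sigma> \<phi>"
    using n by (intro subst_cong) simp
  finally show ?thesis .
qed

text \<open>Derivability from hypotheses whose free variables are treated as constants.\<close>

inductive der :: "fm set \<Rightarrow> fm \<Rightarrow> bool" for \<Gamma> where
  prov: "prov \<phi> \<Longrightarrow> der \<Gamma> \<phi>"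
| hyp: "\<phi> \<in> \<Gamma> \<Longrightarrow> \<phi> \<in> lang b \<Longrightarrow> der \<Gamma> \<phi>"
| mp: "der \<Gamma> (\<phi> \<^bold>\<longrightarrow> \<psi>) \<Longrightarrow> der \<Gamma> \<phi> \<Longrightarrow> der \<Gamma> \<psi>"

lemma der_lang: "der \<Gamma> \<phi> \<Longrightarrow> \<phi> \<in> lang b"
  by (induction rule: der.induct) (auto simp: prov_lang)

lemma der_mono: "der \<Gamma> \<phi> \<Longrightarrow> \<Gamma> \<subseteq> \<Delta> \<Longrightarrow> der \<Delta> \<phi>"
  by (induction rule: der.induct) (auto intro: der.intros)

lemma der_empty: "der {} \<phi> \<Longrightarrow> prov \<phi>"
  by (induction rule: der.induct) (auto intro: provable.modus_ponens)

lemma der_logical: "logical_axiom \<phi> \<Longrightarrow> \<phi> \<in> lang b \<Longrightarrow> der \<Gamma> \<phi>"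
  by (intro der.prov provable.logical)

lemma der_K: "der \<Gamma> \<phi> \<Longrightarrow> \<psi> \<in> lang b \<Longrightarrow> der \<Gamma> (\<psi> \<^bold>\<longrightarrow> \<phi>)"
  by (rule der.mp[of _ \<phi>]) (auto intro!: der_logical logical_axiom.intros dest: der_lang)

lemma der_S:
  assumes "der \<Gamma> (\<phi> \<^bold>\<longrightarrow> \<psi> \<^bold>\<longrightarrow> \<chi>)" "der \<Gamma> (\<phi> \<^bold>\<longrightarrow> \<psi>)"
  shows "der \<Gamma> (\<phi> \<^bold>\<longrightarrow> \<chi>)"
proof -
  have "der \<Gamma> ((\<phi> \<^bold>\<longrightarrow> \<psi> \<^bold>\<longrightarrow> \<chi>) \<^bold>\<longrightarrow> (\<phi> \<^bold>\<longrightarrow> \<psi>) \<^bold>\<longrightarrow> \<phi> \<^bold>\<longrightarrow> \<chi>)"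
    using assms[THEN der_lang] by (intro der_logical logical_axiom.intros) simp
  then show ?thesis using assms by (blast intro: der.mp)
qed

lemma der_id: "\<phi> \<in> lang b \<Longrightarrow> der \<Gamma> (\<phi> \<^bold>\<longrightarrow> \<phi>)"
  by (rule der_S[of _ _ "\<phi> \<^bold>\<longrightarrow> \<phi>"]) (auto intro!: der_logical logical_axiom.intros)

text \<open>In \<open>der\<close> generalisation applies to theorems of the theory only, never to
  consequences of hypotheses; hence no condition on variables appears.\<close>

lemma deduction:
  "der (insert \<phi> \<Gamma>) \<psi> \<Longrightarrow> \<phi> \<in> lang b \<Longrightarrow> der \<Gamma> (\<phi> \<^bold>\<longrightarrow> \<psi>)"
proof (induction rule: der.induct)
  case (hyp \<psi>)
  then show ?case by (cases "\<psi> = \<phi>") (auto intro: der_id der_K der.hyp)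
qed (auto intro: der_K der_S der.prov)

lemma der_dneg: "der \<Gamma> (\<^bold>\<not>\<^bold>\<not>\<phi>) \<Longrightarrow> der \<Gamma> \<phi>"
  by (rule der.mp[of _ "\<^bold>\<not>\<^bold>\<not>\<phi>"]) (auto intro!: der_logical logical_axiom.intros dest: der_lang)

lemma der_bot: "der \<Gamma> \<^bold>\<bottom> \<Longrightarrow> \<phi> \<in> lang b \<Longrightarrow> der \<Gamma> \<phi>"
  by (rule der_dneg, rule der_K) simp_all

lemma der_compact:
  assumes "der (\<Union>k::nat. G k) \<phi>" "incseq G"
  shows "\<exists>k. der (G k) \<phi>"
  using assms(1)
proof (induction rule: der.induct)
  case (mp \<phi> \<psi>)
  then obtain k l where "der (G k) (\<phi> \<^bold>\<longrightarrow> \<psi>)" "der (G l) \<phi>" by blast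
  moreover have "G k \<subseteq> G (max k l)" "G l \<subseteq> G (max k l)"
    using assms(2) by (simp_all add: monoD)
  ultimately have "der (G (max k l)) (\<phi> \<^bold>\<longrightarrow> \<psi>)" "der (G (max k l)) \<phi>"
    by (blast intro: der_mono)+
  then show ?case by (blast intro: der.mp)
qed (auto intro: der.intros)

text \<open>The substitution turns the constant \<open>y\<close> into the variable 0, to be bound by the quantifier.\<close>

lemma der_generalise:
  assumes "der \<Gamma> \<chi>" "\<And>\<gamma>. \<gamma> \<in> \<Gamma> \<Longrightarrow> y \<notin> free_vars \<gamma>"
  shows "der \<Gamma> (\<^bold>\<forall>subst (\<lambda>i. if i = y then Var 0 else Var (Suc i)) \<chi>)"
    (is "der \<Gamma> (\<^bold>\<forall>?s \<chi>)")
  using assms(1)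
proof (induction rule: der.induct)
  case (prov \<phi>)
  then have *: "prov (?s \<phi>)" by (rule prov_subst) simp
  then have "?s \<phi> \<in> lang b" by (rule prov_lang)
  with * show ?case by (intro der.prov provable.generalisation) simp_all
next
  case (hyp \<phi>)
  have "?s \<phi> = subst (\<lambda>i. Var (Suc i)) \<phi>"
    using assms(2)[OF hyp(1)] by (intro subst_cong) auto
  moreover have "subst (\<lambda>i. Var (Suc i)) \<phi> \<in> lang b"
    using hyp(2) by (rule lang_subst) simp
  ultimately have "der \<Gamma> (\<phi> \<^bold>\<longrightarrow> (\<^bold>\<forall>?s \<phi>))"
    using hyp(2) by (auto intro!: der_logical logical_axiom.intros)
  then show ?case using hyp by (blast intro: der.intros)
next
  case (mp \<phi> \<psi>)
  from mp.hyps have "\<phi> \<in> lang b" "\<psi> \<in> lang b" by (auto dest: der_lang)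
  then have "?s \<phi> \<in> lang b" "?s \<psi> \<in> lang b" by (auto intro: lang_subst)
  then have "der \<Gamma> ((\<^bold>\<forall>(?s \<phi> \<^bold>\<longrightarrow> ?s \<psi>)) \<^bold>\<longrightarrow> (\<^bold>\<forall>?s \<phi>) \<^bold>\<longrightarrow> (\<^bold>\<forall>?s \<psi>))"
    by (intro der_logical logical_axiom.intros) simp
  with mp.IH show ?case by (auto intro: der.mp)
qed

text \<open>Since \<open>y\<close> is not free in the quantified formula, renaming \<open>y\<close>
  to the bound variable undoes the instantiation exactly.\<close>

lemma der_generalise_inst:
  assumes "der \<Gamma> (inst \<psi> (Var y))" "\<And>\<gamma>. \<gamma> \<in> \<Gamma> \<Longrightarrow> y \<notin> free_vars \<gamma>" "y \<notin> free_vars (\<^bold>\<forall>\<psi>)"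
  shows "der \<Gamma> (\<^bold>\<forall>\<psi>)"
proof -
  let ?\<rho> = "\<lambda>i. if i = y then Var 0 else Var (Suc i)"
  have "subst ?\<rho> (inst \<psi> (Var y)) = subst Var \<psi>"
    unfolding inst_def subst_subst
    using assms(3) by (intro subst_cong) (auto split: nat.split)
  with der_generalise[OF assms(1,2)] show ?thesis by simp
qed

section \<open>Maximal consistent sets with witnesses\<close>

definition consistent :: "fm set \<Rightarrow> bool" where
  "consistent \<Gamma> \<longleftrightarrow> \<Gamma> \<subseteq> lang b \<and> \<not> der \<Gamma> \<^bold>\<bottom>"

lemma consistent_insert:
  assumes "consistent \<Gamma>" "\<phi> \<in> lang b"
  shows "consistent (insert \<phi> \<Gamma>) \<or> consistent (insert (\<^bold>\<not>\<phi>) \<Gamma>)"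
proof (rule ccontr)
  assume "\<not> ?thesis"
  then have "der \<Gamma> (\<^bold>\<not>\<phi>)" "der \<Gamma> (\<^bold>\<not>\<^bold>\<not>\<phi>)"
    using assms by (auto simp: consistent_def intro: deduction)
  then show False using assms(1) by (auto simp: consistent_def dest: der.mp)
qed

text \<open>Finitely many formulas leave some variable fresh, so variables serve as Henkin constants
  and the language is never enlarged. If the witness axiom were refutable, the instance at the fresh
  variable would be derivable, hence by generalisation the quantified formula, and with it the axiom
  itself.\<close>

lemma consistent_insert_henkin:
  assumes "consistent \<Gamma>" "finite \<Gamma>" "\<psi> \<in> lang b"
  shows "\<exists>y. consistent (insert (inst \<psi> (Var y) \<^bold>\<longrightarrow> (\<^bold>\<forall>\<psi>)) \<Gamma>)"
proof -
  have "finite (free_vars (\<^bold>\<forall>\<psi>) \<union> (\<Union>\<gamma>\<in>\<Gamma>. free_vars \<gamma>))"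
    using assms(2) by (intro finite_UnI finite_UN_I finite_free_vars)
  then obtain y where y: "y \<notin> free_vars (\<^bold>\<forall>\<psi>) \<union> (\<Union>\<gamma>\<in>\<Gamma>. free_vars \<gamma>)"
    using ex_new_if_finite[OF infinite_UNIV_nat] by blast
  let ?i = "inst \<psi> (Var y)" and ?a = "\<^bold>\<forall>\<psi>"
  have lang: "?i \<in> lang b" "?a \<in> lang b" using assms(3) by (auto intro: lang_inst)
  have "\<not> der (insert (?i \<^bold>\<longrightarrow> ?a) \<Gamma>) \<^bold>\<bottom>"
  proof
    assume "der (insert (?i \<^bold>\<longrightarrow> ?a) \<Gamma>) \<^bold>\<bottom>"
    then have neg: "der \<Gamma> (\<^bold>\<not>(?i \<^bold>\<longrightarrow> ?a))"
      using lang by (intro deduction) auto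
    \<comment> \<open>A refuted antecedent would give the implication that \<open>neg\<close>
      excludes; so the instance is derivable.\<close>
    have "der (insert (\<^bold>\<not>?i) \<Gamma>) (?i \<^bold>\<longrightarrow> ?a)"
    proof (rule deduction)
      have "der (insert ?i (insert (\<^bold>\<not>?i) \<Gamma>)) \<^bold>\<bottom>"
        by (rule der.mp[of _ ?i]; rule der.hyp) (use lang in auto)
      then show "der (insert ?i (insert (\<^bold>\<not>?i) \<Gamma>)) ?a"
        by (rule der_bot) (use lang in auto)
    qed (use lang in auto)
    then have "der (insert (\<^bold>\<not>?i) \<Gamma>) \<^bold>\<bottom>"
      using neg by (blast intro: der.mp der_mono)
    then have "der \<Gamma> ?i"
      using der_dneg[OF deduction] lang by auto
    then have "der \<Gamma> ?a" using y by (intro der_generalise_inst) auto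
    then have "der \<Gamma> (?i \<^bold>\<longrightarrow> ?a)" using lang by (intro der_K)
    with neg have "der \<Gamma> \<^bold>\<bottom>" by (rule der.mp)
    with assms(1) show False by (simp add: consistent_def)
  qed
  with assms(1) lang show ?thesis by (auto simp: consistent_def)
qed

text \<open>Keeping the set finite is what leaves fresh witnesses for later steps.\<close>

lemma henkin_step:
  assumes "consistent \<Gamma>" "finite \<Gamma>"
  shows "\<exists>\<Delta>. consistent \<Delta> \<and> finite \<Delta> \<and> \<Gamma> \<subseteq> \<Delta> \<and>
    (\<chi> \<in> lang b \<longrightarrow> (\<chi> \<in> \<Delta> \<or> (\<^bold>\<not>\<chi>) \<in> \<Delta>) \<and>
      (\<forall>\<psi>. \<chi> = (\<^bold>\<forall>\<psi>) \<longrightarrow> (\<exists>y. (inst \<psi> (Var y) \<^bold>\<longrightarrow> (\<^bold>\<forall>\<psi>)) \<in> \<Delta>)))"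
proof (cases "\<chi> \<in> lang b")
  case True
  obtain \<chi>' where \<chi>': "\<chi>' = \<chi> \<or> \<chi>' = (\<^bold>\<not>\<chi>)" "consistent (insert \<chi>' \<Gamma>)"
    using consistent_insert[OF assms(1) True] by blast
  show ?thesis
  proof (cases "\<exists>\<psi>. \<chi> = (\<^bold>\<forall>\<psi>)")
    case False
    then show ?thesis using \<chi>' assms by (intro exI[of _ "insert \<chi>' \<Gamma>"]) auto
  next
    case True
    then obtain \<psi> where \<psi>: "\<chi> = (\<^bold>\<forall>\<psi>)" by blast
    obtain y where "consistent (insert (inst \<psi> (Var y) \<^bold>\<longrightarrow> (\<^bold>\<forall>\<psi>)) (insert \<chi>' \<Gamma>))"
      using consistent_insert_henkin[OF \<chi>'(2), of \<psi>] assms(2) \<open>\<chi> \<in> lang b\<close> \<psi> by auto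
    then show ?thesis using \<chi>' assms \<psi>
      by (intro exI[of _ "insert (inst \<psi> (Var y) \<^bold>\<longrightarrow> (\<^bold>\<forall>\<psi>)) (insert \<chi>' \<Gamma>)"]) auto
  qed
qed (use assms in auto)

definition henkin :: "fm set \<Rightarrow> bool" where
  "henkin H \<longleftrightarrow> consistent H \<and> (\<forall>\<chi>\<in>lang b. \<chi> \<in> H \<or> (\<^bold>\<not>\<chi>) \<in> H) \<and>
    (\<forall>\<psi>\<in>lang b. \<exists>y. (inst \<psi> (Var y) \<^bold>\<longrightarrow> (\<^bold>\<forall>\<psi>)) \<in> H)"

lemma henkin_extension:
  assumes "consistent \<Gamma>" "finite \<Gamma>"
  obtains H where "henkin H" "\<Gamma> \<subseteq> H"
proof -
  let ?step = "\<lambda>n \<Gamma> \<Delta>. \<Gamma> \<subseteq> \<Delta> \<and>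
    (from_nat n \<in> lang b \<longrightarrow> (from_nat n \<in> \<Delta> \<or> (\<^bold>\<not>from_nat n) \<in> \<Delta>) \<and>
      (\<forall>\<psi>. from_nat n = (\<^bold>\<forall>\<psi>) \<longrightarrow> (\<exists>y. (inst \<psi> (Var y) \<^bold>\<longrightarrow> (\<^bold>\<forall>\<psi>)) \<in> \<Delta>)))"
  \<comment> \<open>Dependent choice leaves the first member open; the conjunct for
    \<open>n = 0\<close> pins it to the given set.\<close>
  have "\<exists>G. G 0 = \<Gamma> \<and> (\<forall>n. (consistent (G n) \<and> finite (G n)) \<and> ?step n (G n) (G (Suc n)))"
    using dependent_nat_choice[of "\<lambda>n \<Delta>. consistent \<Delta> \<and> finite \<Delta> \<and> (n = 0 \<longrightarrow> \<Delta> = \<Gamma>)" ?step]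
      assms henkin_step by (smt (verit) nat.distinct(1))
  then obtain G where G0: "G 0 = \<Gamma>" and G: "\<And>n. consistent (G n)" and step: "\<And>n. ?step n (G n) (G (Suc n))"
    by blast
  let ?H = "\<Union>n. G n"
  have mono: "incseq G" using step by (intro incseq_SucI) blast
  have "consistent ?H"
    using G der_compact[OF _ mono] unfolding consistent_def by blast
  moreover have "\<chi> \<in> ?H \<or> (\<^bold>\<not>\<chi>) \<in> ?H" if "\<chi> \<in> lang b" for \<chi>
    using step[of "to_nat \<chi>"] that by auto
  moreover have "\<exists>y. (inst \<psi> (Var y) \<^bold>\<longrightarrow> (\<^bold>\<forall>\<psi>)) \<in> ?H" if "\<psi> \<in> lang b" for \<psi>
    using step[of "to_nat (\<^bold>\<forall>\<psi>)"] that by auto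
  ultimately have "henkin ?H" unfolding henkin_def by blast
  moreover have "\<Gamma> \<subseteq> ?H" using G0 by blast
  ultimately show thesis by (rule that)
qed


end

section \<open>The term model of a Henkin set\<close>

locale henkin_theory = calculus +
  fixes H :: "fm set"
  assumes henkin: "henkin H"
begin

lemma H_lang: "\<phi> \<in> H \<Longrightarrow> \<phi> \<in> lang b"
  using henkin by (auto simp: henkin_def consistent_def)

lemma H_bot [simp]: "\<^bold>\<bottom> \<notin> H"
  using henkin by (auto simp: henkin_def consistent_def intro: der.hyp)

lemma H_der:
  assumes "der H \<phi>"
  shows "\<phi> \<in> H"
proof (rule ccontr)
  assume "\<phi> \<notin> H"
  then have "(\<^bold>\<not>\<phi>) \<in> H" using henkin der_lang[OF assms] by (auto simp: henkin_def)
  then have "der H \<^bold>\<bottom>" using assms H_lang by (blast intro: der.intros)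
  then show False using henkin by (simp add: henkin_def consistent_def)
qed

lemma H_prov: "prov \<phi> \<Longrightarrow> \<phi> \<in> H"
  by (intro H_der der.prov)

lemma H_logical: "logical_axiom \<phi> \<Longrightarrow> \<phi> \<in> lang b \<Longrightarrow> \<phi> \<in> H"
  by (intro H_prov provable.logical)

lemma H_mp: "(\<phi> \<^bold>\<longrightarrow> \<psi>) \<in> H \<Longrightarrow> \<phi> \<in> H \<Longrightarrow> \<psi> \<in> H"
  by (rule H_der, rule der.mp) (auto intro: der.hyp dest: H_lang)

lemma H_Imp:
  assumes "\<phi> \<in> lang b" "\<psi> \<in> lang b"
  shows "(\<phi> \<^bold>\<longrightarrow> \<psi>) \<in> H \<longleftrightarrow> (\<phi> \<in> H \<longrightarrow> \<psi> \<in> H)"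
proof
  assume "\<phi> \<in> H \<longrightarrow> \<psi> \<in> H"
  moreover have "(\<phi> \<^bold>\<longrightarrow> \<psi>) \<in> H" if "\<psi> \<in> H"
    using H_der[OF der_K[OF der.hyp]] that assms by blast
  moreover have "(\<phi> \<^bold>\<longrightarrow> \<psi>) \<in> H" if "\<phi> \<notin> H"
  proof -
    have "(\<^bold>\<not>\<phi>) \<in> H" using henkin assms that by (auto simp: henkin_def)
    then have "der (insert \<phi> H) \<^bold>\<bottom>" using assms by (intro der.mp[of _ \<phi> "\<^bold>\<bottom>"] der.hyp) auto
    then have "der (insert \<phi> H) \<psi>" using assms(2) by (rule der_bot)
    then show ?thesis using assms by (intro H_der deduction)
  qed
  ultimately show "(\<phi> \<^bold>\<longrightarrow> \<psi>) \<in> H" by blast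
qed (auto intro: H_mp)

lemma H_Forall:
  assumes "\<psi> \<in> lang b"
  shows "(\<^bold>\<forall>\<psi>) \<in> H \<longleftrightarrow> (\<forall>t\<in>lang_tm b. inst \<psi> t \<in> H)"
proof
  assume *: "(\<^bold>\<forall>\<psi>) \<in> H"
  show "\<forall>t\<in>lang_tm b. inst \<psi> t \<in> H"
  proof
    fix t assume "t \<in> lang_tm b"
    then have "((\<^bold>\<forall>\<psi>) \<^bold>\<longrightarrow> inst \<psi> t) \<in> H"
      using assms by (intro H_logical logical_axiom.intros) (simp add: lang_inst)
    then show "inst \<psi> t \<in> H" using * by (rule H_mp)
  qed
next
  assume "\<forall>t\<in>lang_tm b. inst \<psi> t \<in> H"
  moreover obtain y where "(inst \<psi> (Var y) \<^bold>\<longrightarrow> (\<^bold>\<forall>\<psi>)) \<in> H"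
    using henkin assms by (auto simp: henkin_def)
  ultimately show "(\<^bold>\<forall>\<psi>) \<in> H" by (auto intro: H_mp)
qed

abbreviation equiv :: "tm \<Rightarrow> tm \<Rightarrow> bool" (infix "\<sim>" 50) where
  "s \<sim> t \<equiv> (s \<^bold>= t) \<in> H"

lemma equiv_lang: "s \<sim> t \<Longrightarrow> s \<in> lang_tm b \<and> t \<in> lang_tm b"
  by (auto dest: H_lang)

lemma equiv_refl: "t \<in> lang_tm b \<Longrightarrow> t \<sim> t"
  by (auto intro!: H_logical logical_axiom.intros)

lemma leibniz:
  assumes "s \<sim> t" "inst \<phi> s \<in> H" "\<phi> \<in> lang b"
  shows "inst \<phi> t \<in> H"
proof -
  have "(s \<^bold>= t \<^bold>\<longrightarrow> inst \<phi> s \<^bold>\<longrightarrow> inst \<phi> t) \<in> H"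
    using assms equiv_lang[OF assms(1)]
    by (intro H_logical logical_axiom.intros) (auto intro: lang_inst)
  then show ?thesis using assms by (blast intro: H_mp)
qed

lemma inst_lift [simp]: "tsubst (case_nat s Var) (lift 1 t) = t"
  by (simp add: tsubst_lift One_nat_def)

text \<open>This and the laws below are Leibniz steps: the place to be rewritten is
  \<open>Var 0\<close>, and lifting protects the rest of the formula from the instantiation. Binary
  symbols take one step per argument.\<close>

lemma equiv_sym: "s \<sim> t \<Longrightarrow> t \<sim> s"
  using leibniz[of s t "Var 0 \<^bold>= lift 1 s"] equiv_lang[of s t]
  by (simp add: inst_def equiv_refl)

lemma equiv_trans: "r \<sim> s \<Longrightarrow> s \<sim> t \<Longrightarrow> r \<sim> t"
  using leibniz[of s t "lift 1 r \<^bold>= Var 0"] equiv_lang[of r s]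
  by (simp add: inst_def)

lemma equiv_Succ: "s \<sim> t \<Longrightarrow> Succ s \<sim> Succ t"
  using leibniz[of s t "Succ (lift 1 s) \<^bold>= Succ (Var 0)"] equiv_lang[of s t]
  by (simp add: inst_def equiv_refl)

lemma equiv_Add:
  assumes "s \<sim> s'" "t \<sim> t'"
  shows "s \<^bold>+ t \<sim> s' \<^bold>+ t'"
  using assms leibniz[of s s' "lift 1 s \<^bold>+ lift 1 t \<^bold>= Var 0 \<^bold>+ lift 1 t"]
    leibniz[of t t' "lift 1 s \<^bold>+ lift 1 t \<^bold>= lift 1 s' \<^bold>+ Var 0"] equiv_lang[of s s'] equiv_lang[of t t']
  by (simp add: inst_def equiv_refl)

lemma equiv_Mul:
  assumes "s \<sim> s'" "t \<sim> t'"
  shows "s \<^bold>* t \<sim> s' \<^bold>* t'"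
  using assms leibniz[of s s' "lift 1 s \<^bold>* lift 1 t \<^bold>= Var 0 \<^bold>* lift 1 t"]
    leibniz[of t t' "lift 1 s \<^bold>* lift 1 t \<^bold>= lift 1 s' \<^bold>* Var 0"] equiv_lang[of s s'] equiv_lang[of t t']
  by (simp add: inst_def equiv_refl)

lemma equiv_Fn: "b \<Longrightarrow> s \<sim> t \<Longrightarrow> Fn s \<sim> Fn t"
  using leibniz[of s t "Fn (lift 1 s) \<^bold>= Fn (Var 0)"] equiv_lang[of s t]
  by (simp add: inst_def equiv_refl)

lemma not_Succ_equiv_Zero:
  assumes "t \<in> lang_tm b"
  shows "\<not> Succ t \<sim> Zero"
proof
  have "prov (subst (\<lambda>_. t) (\<^bold>\<not>(Succ (Var 0) \<^bold>= Zero)))"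
    using T_Succ_nonzero T_lang assms by (intro prov_subst provable.axiom) auto
  then have "(\<^bold>\<not>(Succ t \<^bold>= Zero)) \<in> H" by (intro H_prov) simp
  moreover assume "Succ t \<sim> Zero"
  ultimately have "\<^bold>\<bottom> \<in> H" by (rule H_mp)
  then show False by simp
qed

lemma Succ_equiv_Succ:
  assumes "Succ s \<sim> Succ t"
  shows "s \<sim> t"
proof -
  have "prov (subst (\<lambda>i. if i = 0 then s else t) (Succ (Var 0) \<^bold>= Succ (Var 1) \<^bold>\<longrightarrow> Var 0 \<^bold>= Var 1))"
    using T_Succ_inject T_lang equiv_lang[OF assms] by (intro prov_subst provable.axiom) auto
  then have "(Succ s \<^bold>= Succ t \<^bold>\<longrightarrow> s \<^bold>= t) \<in> H" by (intro H_prov) simp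
  then show ?thesis using assms by (rule H_mp)
qed

lemma num_lang [simp]: "num n \<in> lang_tm b"
  by (induction n) simp_all

lemma num_equiv: "num m \<sim> num n \<Longrightarrow> m = n"
proof (induction m arbitrary: n)
  case 0
  then show ?case
    by (cases n) (auto dest: equiv_sym simp: not_Succ_equiv_Zero)
next
  case (Suc m)
  then show ?case by (cases n) (auto simp: not_Succ_equiv_Zero dest: Succ_equiv_Succ)
qed

text \<open>There are infinitely many classes of terms, since the numerals are pairwise inequivalent;
  so the classes can be numbered by all of \<open>nat\<close> and the term model can live on the whole type
  \<open>nat\<close>.\<close>

lemma term_numbering:
  obtains ix :: "tm \<Rightarrow> nat" where
    "\<And>s t. s \<in> lang_tm b \<Longrightarrow> t \<in> lang_tm b \<Longrightarrow> ix s = ix t \<longleftrightarrow> s \<sim> t"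
    "ix ` lang_tm b = UNIV"
proof -
  define cl where "cl t = {s. s \<sim> t}" for t
  have cl: "cl s = cl t \<longleftrightarrow> s \<sim> t" if "s \<in> lang_tm b" for s t
    using that equiv_refl equiv_sym equiv_trans unfolding cl_def by blast
  have "inj (\<lambda>n. cl (num n))"
    by (rule injI) (auto simp: cl dest: num_equiv)
  then have "infinite (range (\<lambda>n. cl (num n)))" by (simp add: finite_image_iff)
  then have "infinite (cl ` lang_tm b)" by (rule contrapos_nn) (auto elim: finite_subset[rotated])
  moreover have "countable (cl ` lang_tm b)" by simp
  ultimately have bij: "bij_betw (to_nat_on (cl ` lang_tm b)) (cl ` lang_tm b) UNIV"
    by (intro to_nat_on_infinite)
  show thesis
  proof (rule that[of "\<lambda>t. to_nat_on (cl ` lang_tm b) (cl t)"])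
    show "to_nat_on (cl ` lang_tm b) (cl s) = to_nat_on (cl ` lang_tm b) (cl t) \<longleftrightarrow> s \<sim> t"
      if "s \<in> lang_tm b" "t \<in> lang_tm b" for s t
      using inj_on_eq_iff[OF bij_betw_imp_inj_on[OF bij], of "cl s" "cl t"] cl[OF that(1), of t] that
      by blast
    show "(\<lambda>t. to_nat_on (cl ` lang_tm b) (cl t)) ` lang_tm b = UNIV"
      using bij by (simp add: bij_betw_def image_image)
  qed
qed

text \<open>The truth lemma ranges over all assignments induced by substitutions, because the
  quantifier case changes the substitution. Surjectivity of \<open>ix\<close> lets the instances by
  terms exhaust the universe.\<close>

lemma term_model:
  obtains M :: "nat struct" and ix where
    "\<And>\<phi> \<sigma>. \<phi> \<in> lang b \<Longrightarrow> (\<And>i. \<sigma> i \<in> lang_tm b) \<Longrightarrow> sat M (\<lambda>i. ix (\<sigma> i)) \<phi> \<longleftrightarrow> subst \<sigma> \<phi> \<in> H"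
    "ix ` lang_tm b = UNIV"
proof -
  obtain ix :: "tm \<Rightarrow> nat" where
    ix: "\<And>s t. s \<in> lang_tm b \<Longrightarrow> t \<in> lang_tm b \<Longrightarrow> ix s = ix t \<longleftrightarrow> s \<sim> t" and
    surj: "ix ` lang_tm b = UNIV"
    by (rule term_numbering) blast
  define h where "h = inv_into (lang_tm b) ix"
  have h: "h n \<in> lang_tm b" and ixh: "ix (h n) = n" for n
    using surj by (auto simp: h_def inv_into_into f_inv_into_f)
  have hix: "h (ix t) \<sim> t" if "t \<in> lang_tm b" for t
    using ix[OF h that, of "ix t"] by (simp add: ixh)
  \<comment> \<open>Without \<open>f\<close> in the language no term of \<open>lang_tm b\<close>
    contains \<open>Fn\<close>, and the identity is an arbitrary filler for
    \<open>fn_in\<close>.\<close>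
  define M where "M = \<lparr>zero_in = ix Zero, succ_in = (\<lambda>x. ix (Succ (h x))),
    add_in = (\<lambda>x y. ix (h x \<^bold>+ h y)), mul_in = (\<lambda>x y. ix (h x \<^bold>* h y)),
    fn_in = (\<lambda>x. if b then ix (Fn (h x)) else x)\<rparr>"
  have tval: "tval M (\<lambda>i. ix (\<sigma> i)) t = ix (tsubst \<sigma> t)"
    if "t \<in> lang_tm b" and \<sigma>: "\<And>i. \<sigma> i \<in> lang_tm b" for t \<sigma>
    using that(1)
  proof (induction t)
    case (Succ t)
    have "tsubst \<sigma> t \<in> lang_tm b" using Succ.prems \<sigma> by (intro lang_tm_tsubst) auto
    then show ?case using Succ h hix
      by (auto simp: M_def intro!: ix[THEN iffD2] equiv_Succ)
  next
    case (Add s t)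
    have "tsubst \<sigma> s \<in> lang_tm b" "tsubst \<sigma> t \<in> lang_tm b"
      using Add.prems \<sigma> by (auto intro!: lang_tm_tsubst)
    then show ?case using Add h hix
      by (auto simp: M_def intro!: ix[THEN iffD2] equiv_Add)
  next
    case (Mul s t)
    have "tsubst \<sigma> s \<in> lang_tm b" "tsubst \<sigma> t \<in> lang_tm b"
      using Mul.prems \<sigma> by (auto intro!: lang_tm_tsubst)
    then show ?case using Mul h hix
      by (auto simp: M_def intro!: ix[THEN iffD2] equiv_Mul)
  next
    case (Fn t)
    then have b by simp
    then have "tsubst \<sigma> t \<in> lang_tm b" "t \<in> lang_tm b" by (simp_all add: lang_tm_def)
    then show ?case using Fn h hix \<open>b\<close>
      by (auto simp: M_def intro!: ix[THEN iffD2] equiv_Fn)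
  qed (simp_all add: M_def)
  have sat: "sat M (\<lambda>i. ix (\<sigma> i)) \<phi> \<longleftrightarrow> subst \<sigma> \<phi> \<in> H"
    if "\<phi> \<in> lang b" "\<And>i. \<sigma> i \<in> lang_tm b" for \<phi> \<sigma>
    using that
  proof (induction \<phi> arbitrary: \<sigma>)
    case (Eql s t)
    then show ?case by (simp add: tval ix lang_tm_tsubst)
  next
    case (Imp \<phi> \<psi>)
    then show ?case by (simp add: H_Imp lang_subst)
  next
    case (Forall \<psi>)
    let ?\<tau> = "case_nat (Var 0) (\<lambda>i. lift 1 (\<sigma> i))"
    have "subst ?\<tau> \<psi> \<in> lang b"
      using Forall.prems by (intro lang_subst) (auto split: nat.split)
    then have "subst \<sigma> (\<^bold>\<forall>\<psi>) \<in> H \<longleftrightarrow> (\<forall>t\<in>lang_tm b. subst (case_nat t \<sigma>) \<psi> \<in> H)"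
      by (simp add: H_Forall inst_subst)
    also have "\<dots> \<longleftrightarrow> (\<forall>t\<in>lang_tm b. sat M (\<lambda>i. ix (case_nat t \<sigma> i)) \<psi>)"
      using Forall.prems by (intro ball_cong refl Forall.IH[symmetric]) (auto split: nat.split)
    also have "\<dots> \<longleftrightarrow> (\<forall>t\<in>lang_tm b. sat M (case_nat (ix t) (\<lambda>i. ix (\<sigma> i))) \<psi>)"
    proof -
      have "(\<lambda>i. ix (case_nat t \<sigma> i)) = case_nat (ix t) (\<lambda>i. ix (\<sigma> i))" for t
        by (rule ext) (simp split: nat.split)
      then show ?thesis by simp
    qed
    also have "\<dots> \<longleftrightarrow> (\<forall>x. sat M (case_nat x (\<lambda>i. ix (\<sigma> i))) \<psi>)"
      using surj by (metis (no_types, lifting) UNIV_I imageE)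
    finally show ?case by simp
  qed simp
  show thesis using sat surj by (rule that)
qed

end

theorem (in calculus) completeness:
  assumes "\<phi> \<in> lang b" and valid: "\<And>(M :: nat struct) e. models M T \<Longrightarrow> sat M e \<phi>"
  shows "prov \<phi>"
proof (rule ccontr)
  assume "\<not> prov \<phi>"
  then have "consistent {\<^bold>\<not>\<phi>}"
    using assms(1) by (auto simp: consistent_def dest!: deduction intro: der_empty der_dneg)
  then obtain H where "henkin H" "{\<^bold>\<not>\<phi>} \<subseteq> H"
    by (rule henkin_extension) simp_all
  interpret henkin_theory b T H
    by unfold_locales (rule \<open>henkin H\<close>)
  obtain M :: "nat struct" and ix where
    sat: "\<And>\<phi> \<sigma>. \<phi> \<in> lang b \<Longrightarrow> (\<And>i. \<sigma> i \<in> lang_tm b) \<Longrightarrow> sat M (\<lambda>i. ix (\<sigma> i)) \<phi> \<longleftrightarrow> subst \<sigma> \<phi> \<in> H" and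
    surj: "ix ` lang_tm b = UNIV"
    by (rule term_model) blast
  have "sat M e \<psi>" if "\<psi> \<in> T" for \<psi> e
  proof -
    \<comment> \<open>As \<open>ix\<close> is onto, every assignment comes from a substitution.
      Axioms count as universally closed, so all their substitution instances lie in
      \<open>H\<close>.\<close>
    define \<sigma> where "\<sigma> i = inv_into (lang_tm b) ix (e i)" for i
    have \<sigma>: "\<sigma> i \<in> lang_tm b" "ix (\<sigma> i) = e i" for i
      using surj by (auto simp: \<sigma>_def inv_into_into f_inv_into_f)
    have "prov \<psi>" using that T_lang by (auto intro: provable.axiom)
    then have "subst \<sigma> \<psi> \<in> H" using \<sigma> by (intro H_prov prov_subst)
    then show ?thesis using sat[of \<psi> \<sigma>] \<sigma> that T_lang by auto
  qed
  then have "models M T" by (simp add: models_def)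
  then have "sat M (\<lambda>i. ix (Var i)) \<phi>" by (rule valid)
  then have "\<phi> \<in> H" using sat[of \<phi> Var] assms(1) by simp
  moreover have "(\<^bold>\<not>\<phi>) \<in> H" using \<open>{\<^bold>\<not>\<phi>} \<subseteq> H\<close> by simp
  ultimately have "\<^bold>\<bottom> \<in> H" by (rule H_mp[rotated])
  then show False by simp
qed

section \<open>Arithmetic in models of PA\<close>

locale pa_model =
  fixes M :: "'a struct"
  assumes models_PA: "models M PA"
begin

abbreviation nul :: 'a (\<open>\<zero>\<close>) where "\<zero> \<equiv> zero_in M"
abbreviation suc :: "'a \<Rightarrow> 'a" where "suc \<equiv> succ_in M"
abbreviation one :: 'a (\<open>\<one>\<close>) where "\<one> \<equiv> suc \<zero>"
abbreviation pls :: "'a \<Rightarrow> 'a \<Rightarrow> 'a" (infixl \<open>\<oplus>\<close> 65) where "x \<oplus> y \<equiv> add_in M x y"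
abbreviation tms :: "'a \<Rightarrow> 'a \<Rightarrow> 'a" (infixl \<open>\<otimes>\<close> 70) where "x \<otimes> y \<equiv> mul_in M x y"

lemma sat_PA: "\<phi> \<in> PA \<Longrightarrow> sat M e \<phi>"
  using models_PA by (simp add: models_def)

lemma suc_neq_zero [simp]: "suc x \<noteq> \<zero>" "\<zero> \<noteq> suc x"
  using sat_PA[of "\<^bold>\<not>(Succ (Var 0) \<^bold>= Zero)" "\<lambda>_. x"] by (auto simp: PA_def PA_over_def)

lemma suc_inject [simp]: "suc x = suc y \<longleftrightarrow> x = y"
  using sat_PA[of "Succ (Var 0) \<^bold>= Succ (Var 1) \<^bold>\<longrightarrow> Var 0 \<^bold>= Var 1" "case_nat x (\<lambda>_. y)"]
  by (auto simp: PA_def PA_over_def)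

lemma add_zero: "x \<oplus> \<zero> = x"
  using sat_PA[of "Var 0 \<^bold>+ Zero \<^bold>= Var 0" "\<lambda>_. x"] by (auto simp: PA_def PA_over_def)

lemma add_suc: "x \<oplus> suc y = suc (x \<oplus> y)"
  using sat_PA[of "Var 0 \<^bold>+ Succ (Var 1) \<^bold>= Succ (Var 0 \<^bold>+ Var 1)" "case_nat x (\<lambda>_. y)"]
  by (auto simp: PA_def PA_over_def)

lemma mul_zero: "x \<otimes> \<zero> = \<zero>"
  using sat_PA[of "Var 0 \<^bold>* Zero \<^bold>= Zero" "\<lambda>_. x"] by (auto simp: PA_def PA_over_def)

lemma mul_suc: "x \<otimes> suc y = x \<otimes> y \<oplus> x"
  using sat_PA[of "Var 0 \<^bold>* Succ (Var 1) \<^bold>= Var 0 \<^bold>* Var 1 \<^bold>+ Var 0" "case_nat x (\<lambda>_. y)"]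
  by (auto simp: PA_def PA_over_def)

text \<open>The model may be nonstandard, so each later induction inside it must name an
  arithmetical formula; its parameters are passed through \<open>e\<close>.\<close>

lemma sat_induct [consumes 1, case_names zero suc]:
  assumes "arithmetical \<phi>" "sat M (case_nat \<zero> e) \<phi>"
    "\<And>x. sat M (case_nat x e) \<phi> \<Longrightarrow> sat M (case_nat (suc x) e) \<phi>"
  shows "sat M (case_nat x e) \<phi>"
proof -
  have "induction_axiom \<phi> \<in> PA" using assms(1) by (simp add: PA_def PA_over_def L_PA_def)
  then have "sat M e (induction_axiom \<phi>)" by (rule sat_PA)
  moreover have "(\<lambda>i. tval M (case_nat x e) (case_nat (Succ (Var 0)) (\<lambda>i. Var (Suc i)) i)) = case_nat (suc x) e" for x
    by (rule ext) (simp split: nat.split)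
  ultimately show ?thesis using assms(2,3) by (simp add: induction_axiom_def sat_inst sat_subst)
qed

lemma zero_add: "\<zero> \<oplus> x = x"
  using sat_induct[of "Zero \<^bold>+ Var 0 \<^bold>= Var 0" "\<lambda>_. x" x] by (simp add: add_zero add_suc)

lemma suc_add: "suc x \<oplus> y = suc (x \<oplus> y)"
  using sat_induct[of "Succ (Var 1) \<^bold>+ Var 0 \<^bold>= Succ (Var 1 \<^bold>+ Var 0)" "\<lambda>_. x" y]
  by (simp add: add_zero add_suc)

lemma add_commute: "x \<oplus> y = y \<oplus> x"
  using sat_induct[of "Var 1 \<^bold>+ Var 0 \<^bold>= Var 0 \<^bold>+ Var 1" "\<lambda>_. x" y]
  by (simp add: add_zero add_suc zero_add suc_add)

lemma add_assoc: "x \<oplus> y \<oplus> z = x \<oplus> (y \<oplus> z)"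
  using sat_induct[of "Var 1 \<^bold>+ Var 2 \<^bold>+ Var 0 \<^bold>= Var 1 \<^bold>+ (Var 2 \<^bold>+ Var 0)" "case_nat x (\<lambda>_. y)" z]
  by (simp add: add_zero add_suc)

lemma add_left_commute: "y \<oplus> (x \<oplus> z) = x \<oplus> (y \<oplus> z)"
  by (metis add_assoc add_commute)

lemmas add_ac' = add_assoc add_commute add_left_commute

lemma zero_mul: "\<zero> \<otimes> x = \<zero>"
  using sat_induct[of "Zero \<^bold>* Var 0 \<^bold>= Zero" "\<lambda>_. x" x] by (simp add: mul_zero mul_suc add_zero)

lemma suc_mul: "suc x \<otimes> y = x \<otimes> y \<oplus> y"
  using sat_induct[of "Succ (Var 1) \<^bold>* Var 0 \<^bold>= Var 1 \<^bold>* Var 0 \<^bold>+ Var 0" "\<lambda>_. x" y]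
  by (simp add: mul_zero mul_suc add_zero zero_add add_suc suc_add add_ac')

lemma mul_commute: "x \<otimes> y = y \<otimes> x"
  using sat_induct[of "Var 1 \<^bold>* Var 0 \<^bold>= Var 0 \<^bold>* Var 1" "\<lambda>_. x" y]
  by (simp add: mul_zero mul_suc zero_mul suc_mul)

lemma mul_add: "x \<otimes> (y \<oplus> z) = x \<otimes> y \<oplus> x \<otimes> z"
  using sat_induct[of "Var 1 \<^bold>* (Var 2 \<^bold>+ Var 0) \<^bold>= Var 1 \<^bold>* Var 2 \<^bold>+ Var 1 \<^bold>* Var 0" "case_nat x (\<lambda>_. y)" z]
  by (simp add: mul_zero mul_suc add_zero zero_add add_suc suc_add add_ac')

lemma mul_assoc: "x \<otimes> y \<otimes> z = x \<otimes> (y \<otimes> z)"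
  using sat_induct[of "Var 1 \<^bold>* Var 2 \<^bold>* Var 0 \<^bold>= Var 1 \<^bold>* (Var 2 \<^bold>* Var 0)" "case_nat x (\<lambda>_. y)" z]
  by (simp add: mul_zero mul_suc mul_add)

lemma add_right_cancel: "x \<oplus> z = y \<oplus> z \<longleftrightarrow> x = y"
  using sat_induct[of "Var 1 \<^bold>+ Var 0 \<^bold>= Var 2 \<^bold>+ Var 0 \<^bold>\<longrightarrow> Var 1 \<^bold>= Var 2" "case_nat x (\<lambda>_. y)" z]
  by (auto simp: add_zero add_suc)

lemma zero_or_suc: "x = \<zero> \<or> (\<exists>y. x = suc y)"
  using sat_induct[of "Var 0 \<^bold>= Zero \<^bold>\<or> (\<^bold>\<exists>(Var 1 \<^bold>= Succ (Var 0)))" "\<lambda>_. x" x] by auto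

section \<open>Order and subtraction in a model\<close>

definition le :: "'a \<Rightarrow> 'a \<Rightarrow> bool" (infix \<open>\<sqsubseteq>\<close> 50) where
  "x \<sqsubseteq> y \<longleftrightarrow> (\<exists>z. x \<oplus> z = y)"

definition less :: "'a \<Rightarrow> 'a \<Rightarrow> bool" (infix \<open>\<sqsubset>\<close> 50) where
  "x \<sqsubset> y \<longleftrightarrow> suc x \<sqsubseteq> y"

text \<open>The class \<open>linordered_semidom\<close> contains a subtraction. The value zero
  outside the natural domain makes \<open>minus_minus\<close> and \<open>mul_minus\<close> hold
  without side conditions.\<close>

definition minus :: "'a \<Rightarrow> 'a \<Rightarrow> 'a" where
  "minus x y = (if y \<sqsubseteq> x then THE z. y \<oplus> z = x else \<zero>)"

lemma add_eq_zero: "x \<oplus> y = \<zero> \<Longrightarrow> y = \<zero>"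
  using zero_or_suc[of y] by (auto simp: add_suc)

lemma le_linear: "x \<sqsubseteq> y \<or> y \<sqsubseteq> x"
proof -
  have "sat M (case_nat x (\<lambda>_. y)) ((\<^bold>\<exists>(Var 1 \<^bold>+ Var 0 \<^bold>= Var 2)) \<^bold>\<or> (\<^bold>\<exists>(Var 2 \<^bold>+ Var 0 \<^bold>= Var 1)))"
  proof (rule sat_induct)
    fix x
    assume suc: "sat M (case_nat x (\<lambda>_. y)) ((\<^bold>\<exists>(Var 1 \<^bold>+ Var 0 \<^bold>= Var 2)) \<^bold>\<or> (\<^bold>\<exists>(Var 2 \<^bold>+ Var 0 \<^bold>= Var 1)))"
    have "\<exists>z. suc x \<oplus> z = y" if "x \<oplus> z = y" "z \<noteq> \<zero>" for z
      using zero_or_suc[of z] that by (auto simp: suc_add add_suc)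
    moreover have "\<exists>z. y \<oplus> z = suc x" if "x \<oplus> \<zero> = y"
      using that by (auto simp: add_zero add_suc intro!: exI[of _ \<one>])
    moreover have "\<exists>z. y \<oplus> z = suc x" if "y \<oplus> z = x" for z
      using that by (auto simp: add_suc intro!: exI[of _ "suc z"])
    ultimately show "sat M (case_nat (suc x) (\<lambda>_. y)) ((\<^bold>\<exists>(Var 1 \<^bold>+ Var 0 \<^bold>= Var 2)) \<^bold>\<or> (\<^bold>\<exists>(Var 2 \<^bold>+ Var 0 \<^bold>= Var 1)))"
      using suc by simp metis
  qed (auto simp: zero_add)
  then show ?thesis by (auto simp: le_def)
qed

lemma le_antisym: "x \<sqsubseteq> y \<Longrightarrow> y \<sqsubseteq> x \<Longrightarrow> x = y"
proof -
  assume "x \<sqsubseteq> y" "y \<sqsubseteq> x"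
  then obtain a c where "x \<oplus> a = y" "y \<oplus> c = x" by (auto simp: le_def)
  then have "(a \<oplus> c) \<oplus> x = \<zero> \<oplus> x" by (metis add_assoc add_commute zero_add)
  then have "a \<oplus> c = \<zero>" by (simp add: add_right_cancel)
  then have "a = \<zero>" using add_eq_zero add_commute by metis
  then show ?thesis using \<open>x \<oplus> a = y\<close> by (simp add: add_zero)
qed

lemma less_iff: "x \<sqsubset> y \<longleftrightarrow> (\<exists>z. y = x \<oplus> suc z)"
  by (auto simp: less_def le_def suc_add add_suc)

lemma less_le: "x \<sqsubset> y \<longleftrightarrow> x \<sqsubseteq> y \<and> x \<noteq> y"
proof -
  have "x \<oplus> suc z \<noteq> x" for z
    using add_right_cancel[of "suc z" x \<zero>] by (simp add: add_commute[of _ x] add_zero)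
  then have "x \<sqsubset> y \<Longrightarrow> x \<sqsubseteq> y \<and> x \<noteq> y"
    by (auto simp: less_iff le_def) metis
  moreover have "x \<sqsubset> y" if "x \<sqsubseteq> y" "x \<noteq> y"
  proof -
    obtain z where z: "x \<oplus> z = y" using \<open>x \<sqsubseteq> y\<close> by (auto simp: le_def)
    then show ?thesis using zero_or_suc[of z] \<open>x \<noteq> y\<close> by (auto simp: less_iff add_zero)
  qed
  ultimately show ?thesis by blast
qed

lemma minus_eq: "minus (y \<oplus> z) y = z"
  using add_right_cancel unfolding minus_def le_def by (auto simp: add_commute)

lemma minus_zero: "\<not> y \<sqsubset> x \<Longrightarrow> minus x y = \<zero>"
  using minus_eq[of y "\<zero>"] by (auto simp: less_le minus_def add_zero split: if_splits)

lemma le_refl: "x \<sqsubseteq> x"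
  unfolding le_def using add_zero by blast

lemma le_trans: "x \<sqsubseteq> y \<Longrightarrow> y \<sqsubseteq> z \<Longrightarrow> x \<sqsubseteq> z"
  unfolding le_def using add_assoc by metis

lemma minus_minus: "minus (minus x y) z = minus x (y \<oplus> z)"
proof (cases "y \<sqsubseteq> x")
  case True
  then obtain d where d: "x = y \<oplus> d" by (auto simp: le_def)
  show ?thesis
  proof (cases "z \<sqsubseteq> d")
    case True
    then obtain d' where "d = z \<oplus> d'" by (auto simp: le_def)
    then show ?thesis using minus_eq[of "y \<oplus> z" d'] by (simp add: d minus_eq add_assoc)
  next
    case False
    then have "\<not> y \<oplus> z \<sqsubseteq> x"
      unfolding d le_def using add_right_cancel by (metis add_assoc add_commute)
    with False show ?thesis by (simp add: d minus_eq) (simp add: minus_def d)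
  qed
next
  case False
  then have "\<not> y \<oplus> z \<sqsubseteq> x" using add_assoc by (auto simp: le_def)
  moreover have "minus \<zero> z = \<zero>" using zero_or_suc by (metis minus_eq minus_def le_def zero_add add_eq_zero add_zero)
  ultimately show ?thesis using False by (simp add: minus_def[of x])
qed

lemma mul_minus: "x \<otimes> minus y z = minus (x \<otimes> y) (x \<otimes> z)"
proof (cases "z \<sqsubseteq> y")
  case True
  then show ?thesis by (auto simp: le_def minus_eq mul_add)
next
  case False
  then obtain d where "z = y \<oplus> d" using le_linear[of z y] by (auto simp: le_def)
  then have "x \<otimes> y \<sqsubseteq> x \<otimes> z" by (auto simp: le_def mul_add)
  then have "\<not> x \<otimes> z \<sqsubset> x \<otimes> y" using le_antisym by (auto simp: less_le)
  then show ?thesis using False minus_zero[of "x \<otimes> z"] by (simp add: minus_def[of y] mul_zero)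
qed

lemma mul_less_mono:
  assumes "x \<sqsubset> y" "\<zero> \<sqsubset> z"
  shows "z \<otimes> x \<sqsubset> z \<otimes> y"
proof -
  obtain c d where "z = suc c" "y = x \<oplus> suc d"
    using assms by (auto simp: less_iff zero_add)
  then show ?thesis by (auto simp: less_iff mul_add mul_suc add_suc add_assoc)
qed

lemma less_le_not_le: "x \<sqsubset> y \<longleftrightarrow> x \<sqsubseteq> y \<and> \<not> y \<sqsubseteq> x"
  using le_antisym le_refl by (auto simp: less_le)

lemma add_le_mono_left: "x \<sqsubseteq> y \<Longrightarrow> z \<oplus> x \<sqsubseteq> z \<oplus> y"
  by (auto simp: le_def add_assoc)

lemma mul_eq_zero: "x \<noteq> \<zero> \<Longrightarrow> y \<noteq> \<zero> \<Longrightarrow> x \<otimes> y \<noteq> \<zero>"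
  using zero_or_suc[of x] zero_or_suc[of y] by (auto simp: mul_suc add_suc)

lemma minus_add: "x \<sqsubseteq> y \<Longrightarrow> minus y x \<oplus> x = y"
  by (auto simp: le_def minus_eq add_commute[of _ x])

lemma zero_less_one: "\<zero> \<sqsubset> \<one>"
  by (auto simp: less_iff zero_add)

lemma one_mul: "\<one> \<otimes> x = x"
  by (simp add: suc_mul zero_mul zero_add)

lemma add_mul: "(x \<oplus> y) \<otimes> z = x \<otimes> z \<oplus> y \<otimes> z"
  by (simp add: mul_commute[of _ z] mul_add)

sublocale N: linordered_semidom where plus = pls and zero = "\<zero>" and times = tms and one = "\<one>"
  and minus = minus and less_eq = le and less = less
  by unfold_locales (fact add_assoc add_commute zero_add mul_assoc mul_commute one_mul add_mul mul_add
    zero_mul mul_zero minus_eq minus_minus mul_minus less_le_not_le le_refl le_trans le_antisym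
    le_linear add_le_mono_left mul_less_mono mul_eq_zero minus_add zero_less_one suc_neq_zero)+

end

section \<open>Powers of two and strings in models of PA\<close>

lemma num_1 [simp]: "num 1 = Succ Zero"
  by (simp add: One_nat_def)

lemma arith_tm_num [simp]: "arith_tm (num n)"
  by (induction n) simp_all

lemma arithmetical_simps [simp]:
  "arithmetical (s \<^bold>\<le> t) \<longleftrightarrow> arith_tm s \<and> arith_tm t"
  "arithmetical (s \<^bold>< t) \<longleftrightarrow> arith_tm s \<and> arith_tm t"
  "arithmetical (Beta a b i y) \<longleftrightarrow> arith_tm a \<and> arith_tm b \<and> arith_tm i \<and> arith_tm y"
  "arithmetical (Exp2 k p) \<longleftrightarrow> arith_tm k \<and> arith_tm p"
  "arithmetical (Str s) \<longleftrightarrow> arith_tm s"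
  "arithmetical (Len s k) \<longleftrightarrow> arith_tm s \<and> arith_tm k"
  "arithmetical (Prefix s t) \<longleftrightarrow> arith_tm s \<and> arith_tm t"
  by (auto simp: Le_def Less_def Beta_def Exp2_def Str_def Len_def Prefix_def Let_def)

context pa_model
begin

lemma less_suc: "x \<sqsubset> suc y \<longleftrightarrow> x \<sqsubseteq> y"
  by (auto simp: less_iff le_def add_suc)

lemma suc_le: "suc x \<sqsubseteq> y \<longleftrightarrow> x \<sqsubset> y"
  by (simp add: less_def)

lemma zero_le [simp]: "\<zero> \<sqsubseteq> x"
  by (auto simp: le_def zero_add)

lemma le_zero [simp]: "x \<sqsubseteq> \<zero> \<longleftrightarrow> x = \<zero>"
  using le_antisym[of x "\<zero>"] le_refl by auto

lemma mul_left_commute: "y \<otimes> (x \<otimes> z) = x \<otimes> (y \<otimes> z)"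
  by (metis mul_assoc mul_commute)

lemmas ring_simps = add_assoc add_commute add_left_commute mul_assoc mul_commute mul_left_commute
  mul_add add_mul

lemmas suc_simps = add_suc suc_add mul_suc suc_mul add_zero zero_add mul_zero zero_mul

lemma divmod_unique_aux:
  assumes "q \<otimes> m \<oplus> y = q' \<otimes> m \<oplus> y'" "y \<sqsubset> m"
  shows "\<not> q \<sqsubset> q'"
proof
  assume "q \<sqsubset> q'"
  then obtain d where "q' = q \<oplus> suc d" by (auto simp: less_iff)
  with assms(1) have "y \<oplus> q \<otimes> m = (m \<oplus> (d \<otimes> m \<oplus> y')) \<oplus> q \<otimes> m"
    by (simp add: suc_simps ring_simps)
  then have "y = m \<oplus> (d \<otimes> m \<oplus> y')" by (simp only: add_right_cancel)
  then have "m \<sqsubseteq> y" by (auto simp: le_def)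
  with assms(2) show False by (simp add: less_le_not_le)
qed

lemma divmod_unique:
  assumes "q \<otimes> m \<oplus> y = q' \<otimes> m \<oplus> y'" "y \<sqsubset> m" "y' \<sqsubset> m"
  shows "q = q'" "y = y'"
proof -
  show "q = q'"
    using divmod_unique_aux[OF assms(1,2)] divmod_unique_aux[OF assms(1)[symmetric] assms(3)] N.neqE by blast
  with assms(1) show "y = y'" by (simp add: add_right_cancel add_commute[of "q' \<otimes> m"])
qed

definition beta :: "'a \<Rightarrow> 'a \<Rightarrow> 'a \<Rightarrow> 'a \<Rightarrow> bool" where
  "beta a b i y \<longleftrightarrow> y \<sqsubset> suc (suc i \<otimes> b) \<and> (\<exists>q. a = q \<otimes> suc (suc i \<otimes> b) \<oplus> y)"

definition exp2 :: "'a \<Rightarrow> 'a \<Rightarrow> bool" where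
  "exp2 k p \<longleftrightarrow> (\<exists>a b. beta a b \<zero> \<one>
    \<and> (\<forall>i. i \<sqsubset> k \<longrightarrow> (\<exists>y. beta a b i y \<and> beta a b (suc i) (y \<oplus> y))) \<and> beta a b k p)"

definition len :: "'a \<Rightarrow> 'a \<Rightarrow> bool" where
  "len s n \<longleftrightarrow> (\<exists>p. exp2 n p \<and> p \<sqsubseteq> s \<and> s \<sqsubset> p \<oplus> p)"

definition pre :: "'a \<Rightarrow> 'a \<Rightarrow> bool" where
  "pre u v \<longleftrightarrow> u \<noteq> \<zero> \<and> (\<exists>k p r. exp2 k p \<and> r \<sqsubset> p \<and> v = u \<otimes> p \<oplus> r)"

text \<open>Complexity stays opaque: it enters the argument only as an arithmetical property of a
  string and a length.\<close>

definition kge :: "fm \<Rightarrow> nat \<Rightarrow> 'a \<Rightarrow> 'a \<Rightarrow> bool" where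
  "kge U c w n \<longleftrightarrow> sat M (case_nat w (\<lambda>_. n)) (K_ge U c (Var 0) (Var 1))"

lemma sat_Le [simp]: "sat M e (s \<^bold>\<le> t) \<longleftrightarrow> tval M e s \<sqsubseteq> tval M e t"
  by (simp add: Le_def le_def)

lemma sat_Less [simp]: "sat M e (s \<^bold>< t) \<longleftrightarrow> tval M e s \<sqsubset> tval M e t"
  by (simp add: Less_def less_def)

lemma divmod_exists:
  assumes "m \<noteq> \<zero>"
  shows "\<exists>q t. t \<sqsubset> m \<and> x = q \<otimes> m \<oplus> t"
proof -
  let ?\<phi> = "\<^bold>\<exists>\<^bold>\<exists>(Var 0 \<^bold>< Var 3 \<^bold>\<and> Var 2 \<^bold>= Var 1 \<^bold>* Var 3 \<^bold>+ Var 0)"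
  have "sat M (case_nat x (\<lambda>_. m)) ?\<phi>"
  proof (rule sat_induct)
    have "\<zero> \<sqsubset> m" using assms by (simp add: less_le)
    then have "\<exists>q t. t \<sqsubset> m \<and> \<zero> = q \<otimes> m \<oplus> t"
      by (intro exI[of _ "\<zero>"]) (simp add: suc_simps)
    then show "sat M (case_nat \<zero> (\<lambda>_. m)) ?\<phi>" by simp
  next
    fix x assume "sat M (case_nat x (\<lambda>_. m)) ?\<phi>"
    then obtain q t where x: "t \<sqsubset> m" "x = q \<otimes> m \<oplus> t" by auto
    have "\<exists>q t. t \<sqsubset> m \<and> suc x = q \<otimes> m \<oplus> t"
    proof (cases "suc t = m")
      case True
      have "suc x = suc q \<otimes> m \<oplus> \<zero>" using x(2) True by (metis add_suc suc_mul add_zero)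
      moreover have "\<zero> \<sqsubset> m" using assms by (simp add: less_le)
      ultimately show ?thesis by blast
    next
      case False
      then have "suc t \<sqsubset> m" using x(1) by (simp add: less_le[of "suc t"] suc_le)
      then show ?thesis using x(2) by (metis add_suc)
    qed
    then show "sat M (case_nat (suc x) (\<lambda>_. m)) ?\<phi>" by simp
  qed simp
  then show ?thesis by simp
qed

lemma sat_Beta [simp]:
  "sat M e (Beta a b i y) \<longleftrightarrow> beta (tval M e a) (tval M e b) (tval M e i) (tval M e y)"
  by (auto simp: Beta_def beta_def Let_def)

lemma sat_Exp2 [simp]: "sat M e (Exp2 k p) \<longleftrightarrow> exp2 (tval M e k) (tval M e p)"
  by (auto simp: Exp2_def exp2_def)

lemma sat_Str [simp]: "sat M e (Str s) \<longleftrightarrow> tval M e s \<noteq> \<zero>"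
  by (simp add: Str_def)

lemma sat_Len [simp]: "sat M e (Len s n) \<longleftrightarrow> len (tval M e s) (tval M e n)"
  by (auto simp: Len_def len_def)

lemma sat_Prefix [simp]: "sat M e (Prefix u v) \<longleftrightarrow> pre (tval M e u) (tval M e v)"
  by (auto simp: Prefix_def pre_def)

lemma sat_app2: "sat M e (app2 U p w) \<longleftrightarrow> sat M (case_nat (tval M e p) (\<lambda>_. tval M e w)) U"
proof -
  have "(\<lambda>i. tval M e (if i = 0 then p else w)) = case_nat (tval M e p) (\<lambda>_. tval M e w)"
    by (rule ext) (simp split: nat.split)
  then show ?thesis by (simp add: app2_def sat_subst)
qed

primrec nm :: "nat \<Rightarrow> 'a" where
  "nm 0 = \<zero>"
| "nm (Suc n) = suc (nm n)"

lemma tval_num [simp]: "tval M e (num n) = nm n"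
  by (induction n) simp_all

lemma sat_K_ge [simp]: "sat M e (K_ge U c w n) \<longleftrightarrow> kge U c (tval M e w) (tval M e n)"
  by (simp add: kge_def K_ge_def K_eq_def sat_app2)

lemma beta_unique: "beta a b i y \<Longrightarrow> beta a b i y' \<Longrightarrow> y = y'"
  unfolding beta_def using divmod_unique(2) by blast

text \<open>Both pairs of codes are parameters of one induction formula: at each position up to
  \<open>k\<close> the two decoded sequences share a value, which starts at one and is doubled in
  both.\<close>

lemma exp2_unique:
  assumes "exp2 k p" "exp2 k p'"
  shows "p = p'"
proof -
  obtain a b where ab: "beta a b \<zero> \<one>" "beta a b k p"
    "\<And>i. i \<sqsubset> k \<Longrightarrow> \<exists>y. beta a b i y \<and> beta a b (suc i) (y \<oplus> y)"
    using assms(1) by (auto simp: exp2_def)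
  obtain c d where cd: "beta c d \<zero> \<one>" "beta c d k p'"
    "\<And>i. i \<sqsubset> k \<Longrightarrow> \<exists>y. beta c d i y \<and> beta c d (suc i) (y \<oplus> y)"
    using assms(2) by (auto simp: exp2_def)
  let ?\<phi> = "Var 0 \<^bold>\<le> Var 1 \<^bold>\<longrightarrow> (\<^bold>\<exists>(Beta (Var 3) (Var 4) (Var 1) (Var 0) \<^bold>\<and> Beta (Var 5) (Var 6) (Var 1) (Var 0)))"
  let ?e = "case_nat k (case_nat a (case_nat b (case_nat c (\<lambda>_. d))))"
  have "sat M (case_nat k ?e) ?\<phi>"
  proof (rule sat_induct)
    fix x assume IH: "sat M (case_nat x ?e) ?\<phi>"
    have "\<exists>y. beta a b (suc x) y \<and> beta c d (suc x) y" if "suc x \<sqsubseteq> k"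
    proof -
      have "x \<sqsubset> k" using that by (simp add: suc_le)
      moreover obtain y where "beta a b x y" "beta c d x y"
        using IH \<open>x \<sqsubset> k\<close> by (auto simp: less_le)
      ultimately show ?thesis using ab(3) cd(3) beta_unique by metis
    qed
    then show "sat M (case_nat (suc x) ?e) ?\<phi>" by simp
  qed (use ab(1) cd(1) in auto)
  then obtain y where "beta a b k y" "beta c d k y" by (auto simp: le_refl)
  then show ?thesis using ab(2) cd(2) beta_unique by metis
qed

lemma exp2_zero: "exp2 \<zero> p \<Longrightarrow> p = \<one>"
  by (auto simp: exp2_def intro: beta_unique)

text \<open>The same pair \<open>a\<close>, \<open>b\<close> codes the shorter sequence, so the
  existence of powers passes downwards.\<close>

lemma exp2_suc: "exp2 (suc k) q \<Longrightarrow> \<exists>p. exp2 k p \<and> q = p \<oplus> p"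
proof -
  assume "exp2 (suc k) q"
  then obtain a b where ab: "beta a b \<zero> \<one>" "beta a b (suc k) q"
    "\<And>i. i \<sqsubseteq> k \<Longrightarrow> \<exists>y. beta a b i y \<and> beta a b (suc i) (y \<oplus> y)"
    by (auto simp: exp2_def less_suc)
  then obtain y where y: "beta a b k y" "beta a b (suc k) (y \<oplus> y)" using le_refl by blast
  then have "q = y \<oplus> y" using ab(2) beta_unique by blast
  moreover have "exp2 k y" using ab y by (auto simp: exp2_def less_le)
  ultimately show ?thesis by blast
qed

lemma two_cases: "b \<sqsubset> suc \<one> \<longleftrightarrow> b = \<zero> \<or> b = \<one>"
  using zero_or_suc[of b] by (auto simp: less_suc suc_le)

end

section \<open>Arithmetic of lengths and prefixes\<close>

locale pa_exp_model = pa_model +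
  assumes exp2_total: "\<exists>p. exp2 k p"
begin

definition E :: "'a \<Rightarrow> 'a" where
  "E k = (THE p. exp2 k p)"

lemma exp2_iff [simp]: "exp2 k p \<longleftrightarrow> p = E k"
  unfolding E_def using exp2_total exp2_unique by (metis the_equality)

lemma E_zero [simp]: "E \<zero> = \<one>"
  using exp2_zero[of "E \<zero>"] by simp

lemma E_suc: "E (suc k) = E k \<oplus> E k"
  using exp2_suc[of k "E (suc k)"] by simp

text \<open>\<open>E\<close> is not a symbol of the language; inductions about it therefore quantify
  over the values that \<open>Exp2\<close> admits.\<close>

lemma E_neq_zero [simp]: "E k \<noteq> \<zero>"
proof -
  have "sat M (case_nat k (\<lambda>_. k)) (\<^bold>\<forall>(Exp2 (Var 1) (Var 0) \<^bold>\<longrightarrow> \<^bold>\<not>(Var 0 \<^bold>= Zero)))"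
    by (rule sat_induct) (auto simp: E_suc dest: add_eq_zero)
  then show ?thesis by simp
qed

lemma E_add: "E (j \<oplus> k) = E j \<otimes> E k"
proof -
  let ?\<phi> = "\<^bold>\<forall>\<^bold>\<forall>(Exp2 (Var 2) (Var 1) \<^bold>\<longrightarrow> Exp2 (Var 3 \<^bold>+ Var 2) (Var 0) \<^bold>\<longrightarrow> Var 0 \<^bold>= Var 4 \<^bold>* Var 1)"
  have "sat M (case_nat k (case_nat j (\<lambda>_. E j))) ?\<phi>"
    by (rule sat_induct) (auto simp: E_suc suc_simps mul_add)
  then show ?thesis by simp
qed

text \<open>The left side is doubled so that the intervals of codes belonging to different lengths
  are disjoint, which gives \<open>len_unique\<close>.\<close>

lemma E_mono:
  assumes "n \<sqsubset> m"
  shows "E n \<oplus> E n \<sqsubseteq> E m"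
proof -
  obtain d where m: "m = suc n \<oplus> d" using assms by (auto simp: less_def le_def)
  obtain c where "E d = suc c" using zero_or_suc[of "E d"] by auto
  then have "E m = (E n \<oplus> E n) \<oplus> (E n \<oplus> E n) \<otimes> c"
    unfolding m E_add E_suc by (simp add: mul_suc add_commute)
  then show ?thesis by (auto simp: le_def)
qed

lemma len_iff: "len s n \<longleftrightarrow> E n \<sqsubseteq> s \<and> s \<sqsubset> E n \<oplus> E n"
  by (simp add: len_def)

lemma pre_iff: "pre u v \<longleftrightarrow> u \<noteq> \<zero> \<and> (\<exists>k r. r \<sqsubset> E k \<and> v = u \<otimes> E k \<oplus> r)"
  by (simp add: pre_def)

lemma len_neq_zero: "len s n \<Longrightarrow> s \<noteq> \<zero>"
  by (auto simp: len_iff)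

lemma len_unique: "len s n \<Longrightarrow> len s m \<Longrightarrow> n = m"
  using E_mono[of n m] E_mono[of m n] N.neqE[of n m] unfolding len_iff
  by (meson N.leD N.le_less_trans N.order_trans)

text \<open>Appending \<open>k\<close> bits multiplies a code by the power \<open>E k\<close> and
  adds a remainder below it. The upper bound uses that \<open>w\<close> is at least one below
  \<open>E l \<oplus> E l\<close>.\<close>

lemma len_append:
  assumes "len w l" "r \<sqsubset> E k"
  shows "len (w \<otimes> E k \<oplus> r) (l \<oplus> k)"
proof -
  have "E l \<otimes> E k \<sqsubseteq> w \<otimes> E k"
    using assms(1) by (intro N.mult_right_mono) (simp_all add: len_iff)
  then have "E (l \<oplus> k) \<sqsubseteq> w \<otimes> E k \<oplus> r"
    unfolding E_add using N.add_increasing2[OF zero_le, of "E l \<otimes> E k" "w \<otimes> E k" r] by simp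
  moreover have "w \<otimes> E k \<oplus> r \<sqsubset> w \<otimes> E k \<oplus> E k"
    using assms(2) by simp
  moreover have "w \<otimes> E k \<oplus> E k \<sqsubseteq> E (l \<oplus> k) \<oplus> E (l \<oplus> k)"
  proof -
    have "suc w \<sqsubseteq> E l \<oplus> E l" using assms(1) by (simp add: len_iff suc_le)
    then have "suc w \<otimes> E k \<sqsubseteq> (E l \<oplus> E l) \<otimes> E k"
      by (intro N.mult_right_mono) simp_all
    then show ?thesis by (simp add: suc_mul E_add add_mul)
  qed
  ultimately show ?thesis unfolding len_iff by (meson N.less_le_trans)
qed

lemma len_zero [simp]: "len \<one> \<zero>"
  by (simp add: len_iff le_refl suc_simps less_suc)

lemma pre_len:
  assumes "pre u v" "len u i" "len v n"
  obtains k r where "r \<sqsubset> E k" "v = u \<otimes> E k \<oplus> r" "n = i \<oplus> k"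
  using assms len_append len_unique by (metis pre_iff)

lemma pre_len_exists: "pre u v \<Longrightarrow> len u i \<Longrightarrow> \<exists>n. i \<sqsubseteq> n \<and> len v n"
  using len_append by (metis pre_iff le_def)

lemma pre_trans:
  assumes "pre u v" "pre v w"
  shows "pre u w"
proof -
  obtain k r j t where *: "u \<noteq> \<zero>" "r \<sqsubset> E k" "v = u \<otimes> E k \<oplus> r" "t \<sqsubset> E j" "w = v \<otimes> E j \<oplus> t"
    using assms by (auto simp: pre_iff)
  have "r \<otimes> E j \<oplus> t \<sqsubset> suc r \<otimes> E j" using *(4) by (simp add: suc_mul)
  also have "suc r \<otimes> E j \<sqsubseteq> E k \<otimes> E j"
    using *(2) by (intro N.mult_right_mono) (simp_all add: suc_le)
  finally have "r \<otimes> E j \<oplus> t \<sqsubset> E (k \<oplus> j)" by (simp add: E_add)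
  moreover have "w = u \<otimes> E (k \<oplus> j) \<oplus> (r \<otimes> E j \<oplus> t)"
    by (simp add: * E_add ring_simps)
  ultimately show ?thesis using *(1) unfolding pre_iff by blast
qed

lemma pre_refl: "u \<noteq> \<zero> \<Longrightarrow> pre u u"
  unfolding pre_iff by (intro conjI exI[of _ \<zero>]) (simp_all add: suc_simps zero_less_one)

text \<open>The remainder left by the shorter prefix \<open>a\<close> is divided by the power
  belonging to the tail after \<open>b\<close>. This gives a second division of \<open>s\<close> by
  that power, and uniqueness identifies its quotient with \<open>b\<close>.\<close>

lemma pre_comparable:
  assumes "pre a s" "pre b s" "len a i" "len b l" "i \<sqsubseteq> l"
  shows "pre a b"
proof -
  obtain n where n: "len s n" using pre_len_exists[OF assms(1,3)] by blast
  obtain k r where k: "r \<sqsubset> E k" "s = a \<otimes> E k \<oplus> r" "n = i \<oplus> k"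
    using pre_len[OF assms(1,3) n] .
  obtain j t where j: "t \<sqsubset> E j" "s = b \<otimes> E j \<oplus> t" "n = l \<oplus> j"
    using pre_len[OF assms(2,4) n] .
  obtain d where d: "l = i \<oplus> d" using assms(5) by (auto simp: le_def)
  have "k \<oplus> i = (d \<oplus> j) \<oplus> i" using k(3) j(3) d by (simp add: ring_simps)
  then have kd: "k = d \<oplus> j" by (simp only: add_right_cancel)
  obtain r1 r2 where r: "r2 \<sqsubset> E j" "r = r1 \<otimes> E j \<oplus> r2"
    using divmod_exists[OF E_neq_zero] by blast
  have "b \<otimes> E j \<oplus> t = (a \<otimes> E d \<oplus> r1) \<otimes> E j \<oplus> r2"
    using k(2) j(2) r(2) kd by (simp add: E_add ring_simps)
  then have b: "b = a \<otimes> E d \<oplus> r1" using j(1) r(1) by (rule divmod_unique(1))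
  have "r1 \<sqsubset> E d"
  proof (rule ccontr)
    assume "\<not> r1 \<sqsubset> E d"
    then have "E d \<otimes> E j \<sqsubseteq> r1 \<otimes> E j" by (intro N.mult_right_mono) (simp_all add: N.not_less)
    then have "E k \<sqsubseteq> r" unfolding kd E_add r(2)
      using N.add_increasing2[OF zero_le, of "E d \<otimes> E j" "r1 \<otimes> E j" r2] by simp
    with k(1) show False by (simp add: N.not_less[symmetric])
  qed
  with b show ?thesis using assms(1) unfolding pre_iff by blast
qed

lemma pre_eq:
  assumes "pre a b" "len a i" "len b i"
  shows "a = b"
proof -
  obtain k r where k: "r \<sqsubset> E k" "b = a \<otimes> E k \<oplus> r" "i = i \<oplus> k"
    using pre_len[OF assms] .
  from k(3) have "k \<oplus> i = \<zero> \<oplus> i" by (simp add: suc_simps add_commute)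
  then have "k = \<zero>" by (simp only: add_right_cancel)
  with k(1,2) have "r \<sqsubseteq> \<zero>" by (simp add: less_suc)
  then have "r = \<zero>" by (rule le_antisym) simp
  with k(2) \<open>k = \<zero>\<close> show ?thesis by (simp add: suc_simps)
qed

lemma pre_unique: "pre a s \<Longrightarrow> pre b s \<Longrightarrow> len a i \<Longrightarrow> len b i \<Longrightarrow> a = b"
  by (blast intro: pre_eq pre_comparable le_refl)

lemma E_one: "E \<one> = suc \<one>"
  by (simp add: E_suc suc_simps)

lemma pre_bit: "q \<noteq> \<zero> \<Longrightarrow> b = \<zero> \<or> b = \<one> \<Longrightarrow> pre q (q \<oplus> q \<oplus> b)"
  unfolding pre_iff by (intro conjI exI[of _ \<one>] exI[of _ b]) (simp_all add: E_one two_cases suc_simps)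

lemma len_bit: "len q i \<Longrightarrow> b = \<zero> \<or> b = \<one> \<Longrightarrow> len (q \<oplus> q \<oplus> b) (suc i)"
  using len_append[of q i b \<one>] by (simp add: E_one two_cases suc_simps)

lemma pre_one:
  assumes "len s n"
  shows "pre \<one> s"
proof -
  obtain r where r: "s = E n \<oplus> r" using assms by (auto simp: len_iff le_def)
  then have "r \<sqsubset> E n" using assms by (simp add: len_iff)
  then show ?thesis unfolding pre_iff r by (auto simp: suc_mul zero_mul zero_add)
qed

text \<open>Division by two strips the last bit; the bounds on the quotient follow because rounding
  loses less than two.\<close>

lemma len_suc_cases:
  assumes "len t (suc l)"
  obtains q b where "b = \<zero> \<or> b = \<one>" "t = q \<oplus> q \<oplus> b" "len q l"
proof -
  obtain q b where *: "b \<sqsubset> suc \<one>" "t = q \<otimes> suc \<one> \<oplus> b"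
    using divmod_exists[of "suc \<one>" t] by auto
  have t: "t = q \<oplus> q \<oplus> b" using *(2) by (simp add: suc_simps)
  have b: "b \<sqsubseteq> \<one>" using *(1) by (simp add: less_suc)
  have lower: "E l \<oplus> E l \<sqsubseteq> t" and upper: "t \<sqsubset> (E l \<oplus> E l) \<oplus> (E l \<oplus> E l)"
    using assms by (simp_all add: len_iff E_suc)
  have "E l \<sqsubseteq> q"
  proof (rule ccontr)
    assume "\<not> E l \<sqsubseteq> q"
    then have "suc q \<sqsubseteq> E l" by (simp add: suc_le N.not_le)
    then have "suc q \<oplus> suc q \<sqsubseteq> E l \<oplus> E l" by (intro N.add_mono)
    also note lower
    also have "t \<sqsubseteq> q \<oplus> q \<oplus> \<one>" unfolding t using b by simp
    finally have "suc (q \<oplus> q) \<sqsubset> suc (q \<oplus> q)" by (simp add: suc_simps suc_le)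
    then show False by simp
  qed
  moreover have "q \<sqsubset> E l \<oplus> E l"
  proof (rule ccontr)
    assume "\<not> q \<sqsubset> E l \<oplus> E l"
    then have "(E l \<oplus> E l) \<oplus> (E l \<oplus> E l) \<sqsubseteq> q \<oplus> q" by (intro N.add_mono) (simp_all add: N.not_less)
    also have "q \<oplus> q \<sqsubseteq> t" unfolding t by (auto simp: le_def)
    also note upper
    finally show False by simp
  qed
  ultimately have "len q l" by (simp add: len_iff)
  then show thesis using *(1) t by (intro that) (simp_all add: two_cases)
qed

end

section \<open>Models with a random sequence\<close>

text \<open>The innermost condition of \<open>Ext\<close>, named because goodness uses it
  again.\<close>

definition Fine :: "fm \<Rightarrow> nat \<Rightarrow> tm \<Rightarrow> fm" where
  "Fine U c v = (\<^bold>\<forall>\<^bold>\<forall>(Prefix (Var 1) (lift 2 v) \<^bold>\<longrightarrow> Len (Var 1) (Var 0) \<^bold>\<longrightarrow> K_ge U c (Var 1) (Var 0)))"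

lemma arithmetical_K_ge [simp]:
  "arithmetical U \<Longrightarrow> arith_tm w \<Longrightarrow> arith_tm n \<Longrightarrow> arithmetical (K_ge U c w n)"
  by (simp add: K_ge_def K_eq_def app2_def arithmetical_subst)

lemma arithmetical_Fine [simp]: "arithmetical U \<Longrightarrow> arith_tm v \<Longrightarrow> arithmetical (Fine U c v)"
  by (simp add: Fine_def)

lemma arithmetical_Ext: "arithmetical U \<Longrightarrow> arithmetical (Ext U c u)"
  by (simp add: Ext_def)

lemma code_snoc: "code (w @ [b]) = 2 * code w + of_bool b"
  by (simp add: code_def)

lemma initial_segment_Suc: "initial_segment X (Suc n) = initial_segment X n @ [X n]"
  by (simp add: initial_segment_def)

lemma length_initial_segment [simp]: "length (initial_segment X n) = n"
  by (simp add: initial_segment_def)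

context pa_model
begin

lemma nm_add: "nm (a + b) = nm a \<oplus> nm b"
  by (induction a) (simp_all add: suc_simps)

lemma nm_code_snoc: "nm (code (w @ [b])) = nm (code w) \<oplus> nm (code w) \<oplus> nm (of_bool b)"
  by (simp add: code_snoc nm_add mult_2)

lemma nm_of_bool: "nm (of_bool b) = \<zero> \<or> nm (of_bool b) = \<one>"
  by (cases b) (simp_all add: One_nat_def)

definition fine :: "fm \<Rightarrow> nat \<Rightarrow> 'a \<Rightarrow> bool" where
  "fine U c v \<longleftrightarrow> (\<forall>w l. pre w v \<longrightarrow> len w l \<longrightarrow> kge U c w l)"

lemma sat_Fine [simp]: "sat M e (Fine U c v) \<longleftrightarrow> fine U c (tval M e v)"
  by (simp add: Fine_def fine_def)

lemma sat_Ext: "sat M e (Ext U c u) \<longleftrightarrow>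
    (\<forall>m. nm (length u) \<sqsubseteq> m \<longrightarrow> (\<exists>v. len v m \<and> pre (nm (code u)) v \<and> fine U c v))"
  by (simp add: Ext_def fine_def) blast

definition restr :: "'a \<Rightarrow> 'a \<Rightarrow> bool" where
  "restr n s \<longleftrightarrow> len s n \<and> (\<forall>i. i \<sqsubset> n \<longrightarrow> (\<exists>q. len q i \<and> pre (q \<oplus> q \<oplus> fn_in M i) s))"

lemma sat_random_axiom: "sat M e (random_axiom U c) \<longleftrightarrow>
    (\<forall>x. fn_in M x = \<zero> \<or> fn_in M x = \<one>) \<and> (\<forall>n. \<exists>s. restr n s \<and> kge U c s n)"
  by (simp add: random_axiom_def F_restrict_def restr_def) blast

text \<open>\<open>Ext\<close> provides strings only from length \<open>|u|\<close> on. This length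
  is standard, so finitely many downward steps reach the smaller exponents.\<close>

lemma exp2_pred: "(\<exists>p. exp2 (k \<oplus> nm n) p) \<Longrightarrow> \<exists>p. exp2 k p"
  by (induction n) (auto simp: suc_simps dest: exp2_suc)

end

context pa_exp_model
begin

lemma len_nm_code: "len (nm (code w)) (nm (length w))"
proof (induction w rule: rev_induct)
  case (snoc b w)
  then show ?case using len_bit[OF snoc nm_of_bool[of b]] by (simp add: nm_code_snoc)
qed (simp add: code_def One_nat_def)

lemma pre_nm_code_snoc: "pre (nm (code w)) (nm (code (w @ [b])))"
  unfolding nm_code_snoc by (rule pre_bit) (rule len_neq_zero[OF len_nm_code], rule nm_of_bool)

lemma pre_initial_segment: "i \<le> n \<Longrightarrow> pre (nm (code (initial_segment X i))) (nm (code (initial_segment X n)))"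
proof (induction n rule: dec_induct)
  case base
  then show ?case using len_nm_code len_neq_zero pre_refl by blast
next
  case (step n)
  then show ?case unfolding initial_segment_Suc by (blast intro: pre_trans pre_nm_code_snoc)
qed

text \<open>A common prefix of length \<open>i\<close> is continued in both strings by the same bit
  \<open>f(i)\<close>. The induction formula speaks of \<open>s\<close> and \<open>t\<close> instead
  of \<open>f\<close>, so arithmetical induction suffices.\<close>

lemma restr_unique:
  assumes s: "restr n s" and t: "restr n t" and fn: "\<And>x. fn_in M x = \<zero> \<or> fn_in M x = \<one>"
  shows "s = t"
proof -
  let ?\<phi> = "Var 0 \<^bold>\<le> Var 1 \<^bold>\<longrightarrow> (\<^bold>\<exists>(Len (Var 0) (Var 1) \<^bold>\<and> Prefix (Var 0) (Var 3) \<^bold>\<and> Prefix (Var 0) (Var 4)))"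
  let ?e = "case_nat n (case_nat s (\<lambda>_. t))"
  have "sat M (case_nat n ?e) ?\<phi>"
  proof (rule sat_induct)
    have "pre \<one> s" "pre \<one> t" using s t pre_one by (auto simp: restr_def)
    then show "sat M (case_nat \<zero> ?e) ?\<phi>" using len_zero by auto
  next
    fix i assume IH: "sat M (case_nat i ?e) ?\<phi>"
    have "\<exists>q. len q (suc i) \<and> pre q s \<and> pre q t" if "suc i \<sqsubseteq> n"
    proof -
      have i: "i \<sqsubset> n" using that by (simp add: suc_le)
      then obtain q where q: "len q i" "pre q s" "pre q t"
        using IH by (auto simp: less_le)
      \<comment> \<open>The prefix of length \<open>i\<close> provided by \<open>restr\<close> for
        \<open>w\<close> must be \<open>q\<close>, since \<open>w\<close> has only one prefix of
        that length.\<close>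
      have next_bit: "pre (q \<oplus> q \<oplus> fn_in M i) w" if w: "restr n w" "pre q w" for w
      proof -
        obtain q' where q': "len q' i" "pre (q' \<oplus> q' \<oplus> fn_in M i) w"
          using w(1) i by (auto simp: restr_def)
        then have "pre q' w" using pre_trans[OF pre_bit[OF len_neq_zero[OF q'(1)] fn]] by blast
        then have "q' = q" using q(1) q'(1) w(2) by (blast intro: pre_unique)
        with q'(2) show ?thesis by simp
      qed
      show ?thesis using next_bit[OF s q(2)] next_bit[OF t q(3)] len_bit[OF q(1) fn] by blast
    qed
    then show "sat M (case_nat (suc i) ?e) ?\<phi>" by simp blast
  qed simp
  then obtain q where "len q n" "pre q s" "pre q t" by (auto simp: le_refl)
  then show ?thesis using s t pre_eq unfolding restr_def by blast
qed

text \<open>The strings that witness \<open>restr m s\<close> below \<open>l\<close> and the string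
  \<open>w\<close> are prefixes of one \<open>s\<close>, hence comparable. With
  \<open>restr_unique\<close>, every prefix of a restriction is the very string whose complexity the
  random axiom bounds.\<close>

lemma restr_pre:
  assumes "restr m s" "pre w s" "len w l" and fn: "\<And>x. fn_in M x = \<zero> \<or> fn_in M x = \<one>"
  shows "restr l w"
proof -
  have "len s m" using assms(1) by (simp add: restr_def)
  then have lm: "l \<sqsubseteq> m" 
    by (rule pre_len[OF assms(2,3)]) (auto simp: le_def)
  have "\<exists>q. len q i \<and> pre (q \<oplus> q \<oplus> fn_in M i) w" if i: "i \<sqsubset> l" for i
  proof -
    obtain q where q: "len q i" "pre (q \<oplus> q \<oplus> fn_in M i) s"
      using assms(1) N.less_le_trans[OF i lm] by (auto simp: restr_def)
    have "pre (q \<oplus> q \<oplus> fn_in M i) w"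
      using q(2) assms(2) len_bit[OF q(1) fn] assms(3) i[unfolded less_def] by (rule pre_comparable)
    with q(1) show ?thesis by blast
  qed
  with assms(3) show ?thesis by (simp add: restr_def)
qed

end

lemma models_MLR'_imp_MLR'':
  assumes "models M (MLR' U c X)"
  shows "models M (MLR'' U c X)"
proof -
  have PA: "models M PA"
    using assms by (auto simp: models_def MLR'_def PA_def PA_over_def L_PA_f_def)
  then interpret pa_model M by unfold_locales
  have "sat M undefined (random_axiom U c)"
    using assms by (auto simp: models_def MLR'_def)
  then have fn: "fn_in M x = \<zero> \<or> fn_in M x = \<one>" and random: "\<exists>s. restr n s \<and> kge U c s n" for x n
    by (auto simp: sat_random_axiom)
  have fn_nm: "fn_in M (nm i) = nm (of_bool (X i))" for i
  proof -
    have "sat M undefined (Fn (num i) \<^bold>= num (of_bool (X i)))"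
      using assms unfolding models_def MLR'_def by blast
    then show ?thesis by simp
  qed
  interpret pa_exp_model M
  proof
    show "\<exists>p. exp2 k p" for k using random[of k] by (auto simp: restr_def len_def)
  qed
  have "\<exists>v. len v m \<and> pre (nm (code (initial_segment X n))) v \<and> fine U c v" if "nm n \<sqsubseteq> m" for n m
  proof -
    obtain s where s: "restr m s" "kge U c s m" using random by blast
    then have len: "len s m" by (simp add: restr_def)
    \<comment> \<open>The induction is on an actual number \<open>i\<close>: axioms fix
      \<open>f\<close> at standard positions only.\<close>
    have "pre (nm (code (initial_segment X i))) s" if "nm i \<sqsubseteq> m" for i
      using that
    proof (induction i)
      case 0
      then show ?case using pre_one[OF len] by (simp add: initial_segment_def code_def One_nat_def)
    next
      case (Suc i)
      then have i: "nm i \<sqsubset> m" by (simp add: suc_le)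
      let ?u = "nm (code (initial_segment X i))"
      obtain q where q: "len q (nm i)" "pre (q \<oplus> q \<oplus> fn_in M (nm i)) s"
        using s(1) i by (auto simp: restr_def)
      have "pre q s" using pre_trans[OF pre_bit[OF len_neq_zero[OF q(1)] fn]] q(2) by blast
      moreover have "pre ?u s" using Suc.IH i by (simp add: less_le)
      moreover have "len ?u (nm i)" using len_nm_code[of "initial_segment X i"] by simp
      ultimately have "q = ?u" using q(1) by (blast intro: pre_unique)
      with q(2) show ?case by (simp add: initial_segment_Suc nm_code_snoc fn_nm)
    qed
    moreover have "fine U c s"
      unfolding fine_def using restr_pre[OF s(1) _ _ fn] random restr_unique[OF _ _ fn] by metis
    ultimately show ?thesis using len that by blast
  qed
  then show ?thesis
    using PA by (auto simp: models_def MLR''_def sat_Ext)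
qed

section \<open>Expansion by a definable function\<close>

context pa_model
begin

text \<open>Interpreting \<open>f\<close> by an arithmetically definable function preserves the extended induction
  scheme, as nothing new becomes definable.\<close>

lemma tval_fn_update_definable:
  assumes "arithmetical \<gamma>" and \<gamma>: "\<And>x y. sat M (case_nat x (\<lambda>_. y)) \<gamma> \<longleftrightarrow> g x = y"
  shows "\<exists>\<psi>. arithmetical \<psi> \<and> (\<forall>x e. sat M (case_nat x e) \<psi> \<longleftrightarrow> tval (M\<lparr>fn_in := g\<rparr>) e t = x)"
proof (induction t)
  case (Var i)
  show ?case by (rule exI[of _ "Var (Suc i) \<^bold>= Var 0"]) simp
next
  case Zero
  show ?case by (rule exI[of _ "Zero \<^bold>= Var 0"]) simp
next
  case (Succ t)
  then obtain \<psi> where \<psi>: "arithmetical \<psi>"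
    "\<And>x e. sat M (case_nat x e) \<psi> \<longleftrightarrow> tval (M\<lparr>fn_in := g\<rparr>) e t = x" by blast
  \<comment> \<open>Under the new quantifier, index 0 is the value of the subterm, 1 the value of
    the whole term, and the parameters begin at 2.\<close>
  have env: "(\<lambda>i. tval M (case_nat y (case_nat x e)) (case_nat (Var 0) (\<lambda>i. Var (Suc (Suc i))) i)) = case_nat y e" for x y e
    by (rule ext) (simp split: nat.split)
  show ?case
    by (rule exI[of _ "\<^bold>\<exists>(subst (case_nat (Var 0) (\<lambda>i. Var (Suc (Suc i)))) \<psi> \<^bold>\<and> Succ (Var 0) \<^bold>= Var 1)"])
      (auto simp: sat_subst env \<psi> intro!: arithmetical_subst split: nat.split)
next
  case (Add s t)
  then obtain \<psi> \<chi> where \<psi>: "arithmetical \<psi>"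
    "\<And>x e. sat M (case_nat x e) \<psi> \<longleftrightarrow> tval (M\<lparr>fn_in := g\<rparr>) e s = x" and \<chi>: "arithmetical \<chi>"
    "\<And>x e. sat M (case_nat x e) \<chi> \<longleftrightarrow> tval (M\<lparr>fn_in := g\<rparr>) e t = x" by blast
  have env: "(\<lambda>i. tval M (case_nat z (case_nat y (case_nat x e))) (case_nat (Var 1) (\<lambda>i. Var (Suc (Suc (Suc i)))) i)) = case_nat y e"
    "(\<lambda>i. tval M (case_nat z (case_nat y (case_nat x e))) (case_nat (Var 0) (\<lambda>i. Var (Suc (Suc (Suc i)))) i)) = case_nat z e" for x y z e
    by (rule ext, simp split: nat.split)+
  show ?case
    by (rule exI[of _ "\<^bold>\<exists>\<^bold>\<exists>(subst (case_nat (Var 1) (\<lambda>i. Var (Suc (Suc (Suc i))))) \<psi>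
          \<^bold>\<and> subst (case_nat (Var 0) (\<lambda>i. Var (Suc (Suc (Suc i))))) \<chi> \<^bold>\<and> Var 1 \<^bold>+ Var 0 \<^bold>= Var 2)"])
      (auto simp: sat_subst env \<psi> \<chi> intro!: arithmetical_subst split: nat.split)
next
  case (Mul s t)
  then obtain \<psi> \<chi> where \<psi>: "arithmetical \<psi>"
    "\<And>x e. sat M (case_nat x e) \<psi> \<longleftrightarrow> tval (M\<lparr>fn_in := g\<rparr>) e s = x" and \<chi>: "arithmetical \<chi>"
    "\<And>x e. sat M (case_nat x e) \<chi> \<longleftrightarrow> tval (M\<lparr>fn_in := g\<rparr>) e t = x" by blast
  have env: "(\<lambda>i. tval M (case_nat z (case_nat y (case_nat x e))) (case_nat (Var 1) (\<lambda>i. Var (Suc (Suc (Suc i)))) i)) = case_nat y e"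
    "(\<lambda>i. tval M (case_nat z (case_nat y (case_nat x e))) (case_nat (Var 0) (\<lambda>i. Var (Suc (Suc (Suc i)))) i)) = case_nat z e" for x y z e
    by (rule ext, simp split: nat.split)+
  show ?case
    by (rule exI[of _ "\<^bold>\<exists>\<^bold>\<exists>(subst (case_nat (Var 1) (\<lambda>i. Var (Suc (Suc (Suc i))))) \<psi>
          \<^bold>\<and> subst (case_nat (Var 0) (\<lambda>i. Var (Suc (Suc (Suc i))))) \<chi> \<^bold>\<and> Var 1 \<^bold>* Var 0 \<^bold>= Var 2)"])
      (auto simp: sat_subst env \<psi> \<chi> intro!: arithmetical_subst split: nat.split)
next
  case (Fn t)
  then obtain \<psi> where \<psi>: "arithmetical \<psi>"
    "\<And>x e. sat M (case_nat x e) \<psi> \<longleftrightarrow> tval (M\<lparr>fn_in := g\<rparr>) e t = x" by blast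
  \<comment> \<open>The second substitution feeds the value of the subterm to
    \<open>\<gamma>\<close> as argument and the value of the whole term as result;
    \<open>\<gamma>\<close> reads its result at every index other than 0.\<close>
  have env: "(\<lambda>i. tval M (case_nat y (case_nat x e)) (case_nat (Var 0) (\<lambda>i. Var (Suc (Suc i))) i)) = case_nat y e"
    "(\<lambda>i. tval M (case_nat y (case_nat x e)) (case_nat (Var 0) (\<lambda>i. Var 1) i)) = case_nat y (\<lambda>_. x)" for x y e
    by (rule ext, simp split: nat.split)+
  show ?case
    by (rule exI[of _ "\<^bold>\<exists>(subst (case_nat (Var 0) (\<lambda>i. Var (Suc (Suc i)))) \<psi> \<^bold>\<and> subst (case_nat (Var 0) (\<lambda>i. Var 1)) \<gamma>)"])
      (auto simp: sat_subst env \<psi> \<gamma> assms(1) intro!: arithmetical_subst split: nat.split)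
qed

lemma sat_fn_update_definable:
  assumes "arithmetical \<gamma>" "\<And>x y. sat M (case_nat x (\<lambda>_. y)) \<gamma> \<longleftrightarrow> g x = y"
  shows "\<exists>\<psi>. arithmetical \<psi> \<and> (\<forall>e. sat M e \<psi> \<longleftrightarrow> sat (M\<lparr>fn_in := g\<rparr>) e \<phi>)"
proof (induction \<phi>)
  case Bot
  show ?case by (rule exI[of _ "\<^bold>\<bottom>"]) simp
next
  case (Eql s t)
  obtain \<psi> where \<psi>: "arithmetical \<psi>"
    "\<And>x e. sat M (case_nat x e) \<psi> \<longleftrightarrow> tval (M\<lparr>fn_in := g\<rparr>) e s = x"
    using tval_fn_update_definable[OF assms] by blast
  obtain \<chi> where \<chi>: "arithmetical \<chi>"
    "\<And>x e. sat M (case_nat x e) \<chi> \<longleftrightarrow> tval (M\<lparr>fn_in := g\<rparr>) e t = x"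
    using tval_fn_update_definable[OF assms] by blast
  show ?case by (rule exI[of _ "\<^bold>\<exists>(\<psi> \<^bold>\<and> \<chi>)"]) (auto simp: \<psi> \<chi>)
next
  case (Imp \<phi>1 \<phi>2)
  then obtain \<psi> \<chi> where "arithmetical \<psi>" "\<forall>e. sat M e \<psi> \<longleftrightarrow> sat (M\<lparr>fn_in := g\<rparr>) e \<phi>1"
    "arithmetical \<chi>" "\<forall>e. sat M e \<chi> \<longleftrightarrow> sat (M\<lparr>fn_in := g\<rparr>) e \<phi>2" by blast
  then show ?case by (intro exI[of _ "\<psi> \<^bold>\<longrightarrow> \<chi>"]) simp
next
  case (Forall \<phi>)
  then obtain \<psi> where "arithmetical \<psi>" "\<forall>e. sat M e \<psi> \<longleftrightarrow> sat (M\<lparr>fn_in := g\<rparr>) e \<phi>" by blast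
  then show ?case by (intro exI[of _ "\<^bold>\<forall>\<psi>"]) simp
qed

lemma models_PA_over_fn_update:
  assumes "arithmetical \<gamma>" "\<And>x y. sat M (case_nat x (\<lambda>_. y)) \<gamma> \<longleftrightarrow> g x = y"
  shows "models (M\<lparr>fn_in := g\<rparr>) (PA_over L)"
proof -
  let ?M = "M\<lparr>fn_in := g\<rparr>"
  have "sat ?M e (induction_axiom \<phi>)" for e \<phi>
  proof -
    obtain \<psi> where \<psi>: "arithmetical \<psi>" "\<And>e. sat ?M e \<phi> \<longleftrightarrow> sat M e \<psi>"
      using sat_fn_update_definable[OF assms] by metis
    have env: "(\<lambda>i. tval ?M (case_nat x e) (case_nat (Succ (Var 0)) (\<lambda>i. Var (Suc i)) i)) = case_nat (suc x) e" for x
      by (rule ext) (simp split: nat.split)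
    show ?thesis
      using sat_induct[OF \<psi>(1), of e] by (simp add: induction_axiom_def sat_inst sat_subst env \<psi>(2))
  qed
  then show ?thesis
    by (auto simp: models_def PA_over_def suc_simps)
qed

end

section \<open>The leftmost path\<close>

text \<open>The string \<open>u\<close> constrains the long extension and not \<open>s\<close>
  itself, so one formula covers strings shorter and longer than \<open>u\<close>.\<close>

definition Good :: "fm \<Rightarrow> nat \<Rightarrow> bool list \<Rightarrow> tm \<Rightarrow> tm \<Rightarrow> fm" where
  "Good U c u l s = (Len s l \<^bold>\<and> (\<^bold>\<forall>\<^bold>\<exists>\<^bold>\<exists>(Var 2 \<^bold>\<le> Var 1 \<^bold>\<and> Len (Var 0) (Var 1) \<^bold>\<and>
     Prefix (lift 3 s) (Var 0) \<^bold>\<and> Prefix (num (code u)) (Var 0) \<^bold>\<and> Fine U c (Var 0))))"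

definition Path :: "fm \<Rightarrow> nat \<Rightarrow> bool list \<Rightarrow> tm \<Rightarrow> tm \<Rightarrow> fm" where
  "Path U c u l s = (Good U c u l s \<^bold>\<and> (\<^bold>\<forall>(Good U c u (lift 1 l) (Var 0) \<^bold>\<longrightarrow> lift 1 s \<^bold>\<le> Var 0)))"

locale ext_model = pa_exp_model +
  fixes U :: fm and c :: nat and u :: "bool list"
  assumes arithmetical_U: "arithmetical U"
    and ext: "nm (length u) \<sqsubseteq> m \<Longrightarrow> \<exists>v. len v m \<and> pre (nm (code u)) v \<and> fine U c v"
begin

definition good :: "'a \<Rightarrow> 'a \<Rightarrow> bool" where
  "good l s \<longleftrightarrow> len s l \<and>
    (\<forall>m. \<exists>k v. m \<sqsubseteq> k \<and> len v k \<and> pre s v \<and> pre (nm (code u)) v \<and> fine U c v)"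

definition path :: "'a \<Rightarrow> 'a \<Rightarrow> bool" where
  "path l s \<longleftrightarrow> good l s \<and> (\<forall>t. good l t \<longrightarrow> s \<sqsubseteq> t)"

lemma sat_Good [simp]: "sat M e (Good U c u l s) \<longleftrightarrow> good (tval M e l) (tval M e s)"
  by (simp add: Good_def good_def conj_ac)

lemma sat_Path [simp]: "sat M e (Path U c u l s) \<longleftrightarrow> path (tval M e l) (tval M e s)"
  by (simp add: Path_def path_def)

lemma arithmetical_Good [simp]: "arith_tm l \<Longrightarrow> arith_tm s \<Longrightarrow> arithmetical (Good U c u l s)"
  by (simp add: Good_def arithmetical_U)

lemma arithmetical_Path [simp]: "arith_tm l \<Longrightarrow> arith_tm s \<Longrightarrow> arithmetical (Path U c u l s)"
  by (simp add: Path_def)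

lemma good_len: "good l s \<Longrightarrow> len s l"
  by (simp add: good_def)

lemma good_zero: "good \<zero> \<one>"
proof -
  have "\<exists>k v. m \<sqsubseteq> k \<and> len v k \<and> pre \<one> v \<and> pre (nm (code u)) v \<and> fine U c v" for m
  proof -
    \<comment> \<open>Adding \<open>|u|\<close> meets the lower bound on lengths in
      \<open>ext\<close>.\<close>
    have "nm (length u) \<sqsubseteq> m \<oplus> nm (length u)" "m \<sqsubseteq> m \<oplus> nm (length u)"
      by (auto simp: le_def add_commute)
    then show ?thesis using ext pre_one by blast
  qed
  then show ?thesis by (simp add: good_def)
qed

lemma good_pre: "good k t \<Longrightarrow> pre s t \<Longrightarrow> len s l \<Longrightarrow> good l s"
  unfolding good_def using pre_trans by metis

text \<open>The next bit tells whether the remainder lies in the lower or the upper half of its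
  range.\<close>

lemma pre_extend_bit:
  assumes "pre s v" "len s l" "len v k" "suc l \<sqsubseteq> k"
  shows "\<exists>b. (b = \<zero> \<or> b = \<one>) \<and> pre (s \<oplus> s \<oplus> b) v"
proof -
  obtain j r where j: "r \<sqsubset> E j" "v = s \<otimes> E j \<oplus> r" "k = l \<oplus> j"
    using pre_len[OF assms(1,2,3)] .
  have "j \<noteq> \<zero>" using assms(4) j(3) by (auto simp: suc_le add_zero)
  then obtain d where d: "j = suc d" using zero_or_suc by blast
  have s: "s \<noteq> \<zero>" using assms(2) by (rule len_neq_zero)
  have nz: "s \<oplus> s \<oplus> b \<noteq> \<zero>" for b
    using s by (metis add_assoc add_commute add_eq_zero)
  show ?thesis
  proof (cases "r \<sqsubset> E d")
    case True
    have "v = (s \<oplus> s \<oplus> \<zero>) \<otimes> E d \<oplus> r"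
      by (simp add: j(2) d E_suc mul_add add_mul add_zero)
    then show ?thesis using True nz unfolding pre_iff by blast
  next
    case False
    then obtain r' where r': "r = E d \<oplus> r'" by (auto simp: N.not_less le_def)
    then have "r' \<sqsubset> E d" using j(1) by (simp add: d E_suc)
    moreover have "v = (s \<oplus> s \<oplus> \<one>) \<otimes> E d \<oplus> r'"
      by (simp add: j(2) d E_suc mul_add add_mul add_assoc r' suc_mul zero_mul zero_add suc_add add_suc)
    ultimately show ?thesis using nz unfolding pre_iff by blast
  qed
qed

text \<open>The step of Koenig's lemma: if both one-bit extensions had suitable extensions of
  bounded length only, so would \<open>s\<close>.\<close>

lemma good_suc:
  assumes "good l s"
  shows "\<exists>b. (b = \<zero> \<or> b = \<one>) \<and> good (suc l) (s \<oplus> s \<oplus> b)"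
proof (rule ccontr)
  assume *: "\<not> ?thesis"
  have s: "len s l" using assms by (rule good_len)
  have "\<exists>m. \<forall>k v. \<not> (m \<sqsubseteq> k \<and> len v k \<and> pre (s \<oplus> s \<oplus> b) v \<and> pre (nm (code u)) v \<and> fine U c v)"
    if "b = \<zero> \<or> b = \<one>" for b
    using * that len_bit[OF s that] by (simp add: good_def) blast
  then obtain m0 m1 where
    m0: "\<And>k v. \<not> (m0 \<sqsubseteq> k \<and> len v k \<and> pre (s \<oplus> s \<oplus> \<zero>) v \<and> pre (nm (code u)) v \<and> fine U c v)" and
    m1: "\<And>k v. \<not> (m1 \<sqsubseteq> k \<and> len v k \<and> pre (s \<oplus> s \<oplus> \<one>) v \<and> pre (nm (code u)) v \<and> fine U c v)"
    by metis
  \<comment> \<open>The sum replaces a maximum of three bounds; \<open>suc l\<close> guarantees that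
    \<open>v\<close> has a bit after \<open>s\<close>.\<close>
  obtain k v where kv: "m0 \<oplus> (m1 \<oplus> suc l) \<sqsubseteq> k" "len v k" "pre s v" "pre (nm (code u)) v" "fine U c v"
    using assms unfolding good_def by blast
  have "m0 \<sqsubseteq> m0 \<oplus> (m1 \<oplus> suc l)" "m1 \<sqsubseteq> m0 \<oplus> (m1 \<oplus> suc l)" "suc l \<sqsubseteq> m0 \<oplus> (m1 \<oplus> suc l)"
    unfolding le_def using add_assoc add_commute by metis+
  then have "m0 \<sqsubseteq> k" "m1 \<sqsubseteq> k" "suc l \<sqsubseteq> k" using kv(1) le_trans by blast+
  then show False using pre_extend_bit[OF kv(3) s kv(2)] kv m0 m1 by blast
qed

lemma good_exists: "\<exists>s. good l s"
proof -
  have "sat M (case_nat l (\<lambda>_. l)) (\<^bold>\<exists>(Good U c u (Var 1) (Var 0)))"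
  proof (rule sat_induct)
    fix x assume "sat M (case_nat x (\<lambda>_. l)) (\<^bold>\<exists>(Good U c u (Var 1) (Var 0)))"
    then show "sat M (case_nat (suc x) (\<lambda>_. l)) (\<^bold>\<exists>(Good U c u (Var 1) (Var 0)))"
      using good_suc by auto
  qed (use good_zero in auto)
  then show ?thesis by simp
qed

text \<open>The least number principle, by induction on the absence of good numbers up to
  \<open>x\<close>.\<close>

lemma path_exists: "\<exists>s. path l s"
proof (rule ccontr)
  assume *: "\<not> ?thesis"
  have "sat M (case_nat x (\<lambda>_. l)) (\<^bold>\<forall>(Var 0 \<^bold>\<le> Var 1 \<^bold>\<longrightarrow> \<^bold>\<not>(Good U c u (Var 2) (Var 0))))" for x
  proof (rule sat_induct)
    have "\<not> good l \<zero>" using * by (auto simp: path_def)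
    then show "sat M (case_nat \<zero> (\<lambda>_. l)) (\<^bold>\<forall>(Var 0 \<^bold>\<le> Var 1 \<^bold>\<longrightarrow> \<^bold>\<not>(Good U c u (Var 2) (Var 0))))" by simp
  next
    fix x assume "sat M (case_nat x (\<lambda>_. l)) (\<^bold>\<forall>(Var 0 \<^bold>\<le> Var 1 \<^bold>\<longrightarrow> \<^bold>\<not>(Good U c u (Var 2) (Var 0))))"
    then have IH: "\<not> good l y" if "y \<sqsubseteq> x" for y using that by simp
    then have "suc x \<sqsubseteq> t" if "good l t" for t using that by (auto simp: suc_le N.not_le[symmetric])
    then have "\<not> good l (suc x)" using * by (auto simp: path_def)
    then have "\<not> good l y" if "y \<sqsubseteq> suc x" for y
      using IH that less_le[of y "suc x"] by (auto simp: less_suc)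
    then show "sat M (case_nat (suc x) (\<lambda>_. l)) (\<^bold>\<forall>(Var 0 \<^bold>\<le> Var 1 \<^bold>\<longrightarrow> \<^bold>\<not>(Good U c u (Var 2) (Var 0))))" by simp
  qed simp
  then have "\<not> good l y" if "y \<sqsubseteq> x" for x y using that by simp
  then show False using good_exists le_refl by blast
qed

section \<open>The path of least good strings and its bits\<close>

definition least :: "'a \<Rightarrow> 'a" where
  "least l = (THE s. path l s)"

lemma path_iff [simp]: "path l s \<longleftrightarrow> s = least l"
proof -
  have "path l s \<Longrightarrow> path l t \<Longrightarrow> s = t" for s t
    by (auto simp: path_def intro: le_antisym)
  then show ?thesis unfolding least_def using path_exists by (metis the_equality)
qed

lemma good_least: "good l (least l)"
  using path_iff[of l "least l"] by (simp only: path_def) simp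

lemma least_le: "good l t \<Longrightarrow> least l \<sqsubseteq> t"
  using path_iff[of l "least l"] by (simp only: path_def) simp

lemma len_least: "len (least l) l"
  using good_least by (rule good_len)

text \<open>Dropping the last bit of \<open>least (suc l)\<close> leaves a good \<open>q\<close>, so
  \<open>least l\<close> is at most \<open>q\<close>. Were it smaller, its good one-bit extension
  would have a code of at most \<open>2 * least l + 1\<close>, which is less than
  \<open>2 * q\<close> and thus below \<open>least (suc l)\<close>. Hence the least strings
  cohere.\<close>

lemma least_suc: "\<exists>b. (b = \<zero> \<or> b = \<one>) \<and> least (suc l) = least l \<oplus> least l \<oplus> b"
proof -
  obtain q b where q: "b = \<zero> \<or> b = \<one>" "least (suc l) = q \<oplus> q \<oplus> b" "len q l"
    using len_suc_cases[OF len_least] by blast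
  have "pre q (least (suc l))" unfolding q(2) using len_neq_zero[OF q(3)] q(1) by (rule pre_bit)
  then have "good l q" using good_least q(3) by (blast intro: good_pre)
  then have "least l \<sqsubseteq> q" by (rule least_le)
  moreover have "\<not> least l \<sqsubset> q"
  proof
    assume "least l \<sqsubset> q"
    then have "suc (least l) \<oplus> suc (least l) \<sqsubseteq> q \<oplus> q" by (intro N.add_mono) (simp_all add: suc_le)
    also have "q \<oplus> q \<sqsubseteq> least (suc l)" unfolding q(2) by (auto simp: le_def)
    also obtain b' where b': "b' = \<zero> \<or> b' = \<one>" "good (suc l) (least l \<oplus> least l \<oplus> b')"
      using good_suc[OF good_least] by blast
    note least_le[OF b'(2)]
    also have "least l \<oplus> least l \<oplus> b' \<sqsubseteq> least l \<oplus> least l \<oplus> \<one>"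
      using b'(1) by (auto simp: le_refl)
    finally show False by (simp add: suc_simps suc_le)
  qed
  ultimately have "q = least l" by (auto simp: less_le)
  with q show ?thesis by blast
qed

lemma pre_least: "i \<sqsubseteq> n \<Longrightarrow> pre (least i) (least n)"
proof -
  let ?\<phi> = "Var 1 \<^bold>\<le> Var 0 \<^bold>\<longrightarrow> (\<^bold>\<forall>\<^bold>\<forall>(Path U c u (Var 3) (Var 1) \<^bold>\<longrightarrow> Path U c u (Var 2) (Var 0) \<^bold>\<longrightarrow> Prefix (Var 1) (Var 0)))"
  have refl: "pre (least i) (least i)" using len_neq_zero[OF len_least] by (rule pre_refl)
  have "sat M (case_nat n (\<lambda>_. i)) ?\<phi>"
  proof (rule sat_induct)
    fix n assume IH: "sat M (case_nat n (\<lambda>_. i)) ?\<phi>"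
    have "pre (least i) (least (suc n))" if "i \<sqsubseteq> suc n"
    proof (cases "i = suc n")
      case False
      then have "i \<sqsubseteq> n" using that by (simp add: less_le[of i "suc n"] flip: less_suc)
      then have "pre (least i) (least n)" using IH by simp
      moreover have "pre (least n) (least (suc n))"
        using least_suc[of n] pre_bit[OF len_neq_zero[OF len_least]] by metis
      ultimately show ?thesis by (rule pre_trans)
    qed (use refl in simp)
    then show "sat M (case_nat (suc n) (\<lambda>_. i)) ?\<phi>" by simp
  qed (use refl in auto)
  then show "i \<sqsubseteq> n \<Longrightarrow> pre (least i) (least n)" by simp
qed

lemma good_kge: "good l s \<Longrightarrow> kge U c s l"
  unfolding good_def fine_def by blast

text \<open>Both strings are prefixes of one long extension and equally long. This forces the
  leftmost path through \<open>u\<close>.\<close>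

lemma good_length: "good (nm (length u)) s \<Longrightarrow> s = nm (code u)"
  unfolding good_def using len_nm_code pre_unique by metis

definition bit :: "'a \<Rightarrow> 'a" where
  "bit i = (if least (suc i) = least i \<oplus> least i then \<zero> else \<one>)"

lemma bit_cases: "bit i = \<zero> \<or> bit i = \<one>"
  by (simp add: bit_def)

lemma least_suc_eq: "least (suc i) = least i \<oplus> least i \<oplus> b \<longleftrightarrow> bit i = b"
proof -
  have *: "x \<oplus> a = x \<oplus> b \<longleftrightarrow> a = b" for x a b by simp
  obtain b' where b': "b' = \<zero> \<or> b' = \<one>" "least (suc i) = least i \<oplus> least i \<oplus> b'"
    using least_suc by blast
  then have "bit i = b'" using *[of "least i \<oplus> least i" _ \<zero>] by (auto simp: bit_def add_zero)
  then show ?thesis using b' * by metis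
qed

text \<open>Under the two quantifiers the argument is \<open>Var 2\<close> and the value
  \<open>Var 3\<close>, in the variable format expected by
  \<open>models_PA_over_fn_update\<close>.\<close>

definition Bit_graph :: fm where
  "Bit_graph = (\<^bold>\<exists>\<^bold>\<exists>(Path U c u (Var 2) (Var 1) \<^bold>\<and> Path U c u (Succ (Var 2)) (Var 0) \<^bold>\<and>
      Var 0 \<^bold>= Var 1 \<^bold>+ Var 1 \<^bold>+ Var 3))"

lemma arithmetical_Bit_graph: "arithmetical Bit_graph"
  by (simp add: Bit_graph_def)

lemma sat_Bit_graph: "sat M (case_nat x (\<lambda>_. y)) Bit_graph \<longleftrightarrow> bit x = y"
  by (simp add: Bit_graph_def least_suc_eq)

lemma bit_initial_segment:
  assumes "u = initial_segment X (length u)" "i < length u"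
  shows "bit (nm i) = nm (of_bool (X i))"
proof -
  have nm_le: "nm j \<sqsubseteq> nm n" if "j \<le> n" for j n
    using that nm_add[of j "n - j"] by (auto simp: le_def)
  \<comment> \<open>The path equals \<open>u\<close> at length \<open>|u|\<close>, so its shorter
    strings are the prefixes of \<open>u\<close>.\<close>
  have least: "least (nm j) = nm (code (initial_segment X j))" if "j \<le> length u" for j
  proof -
    have "pre (least (nm j)) (nm (code u))"
      using pre_least[OF nm_le[OF that]] good_length[OF good_least] by simp
    moreover have "pre (nm (code (initial_segment X j))) (nm (code u))"
      using pre_initial_segment[OF that, of X] assms(1) by simp
    moreover have "len (nm (code (initial_segment X j))) (nm j)"
      using len_nm_code[of "initial_segment X j"] by simp
    ultimately show ?thesis using len_least by (blast intro: pre_unique)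
  qed
  have "least (suc (nm i)) = least (nm i) \<oplus> least (nm i) \<oplus> nm (of_bool (X i))"
    using least[of i] least[of "Suc i"] assms(2) by (simp add: initial_segment_Suc nm_code_snoc)
  then show ?thesis by (simp add: least_suc_eq)
qed

lemma models_bit:
  assumes "u = initial_segment X (length u)"
  shows "models (M\<lparr>fn_in := bit\<rparr>) (PA_over L \<union> {random_axiom U c} \<union>
    {Fn (num i) \<^bold>= num (of_bool (X i)) | i. i < length u})"
proof -
  let ?M = "M\<lparr>fn_in := bit\<rparr>"
  have PA_over: "models ?M (PA_over L)" for L
    using arithmetical_Bit_graph sat_Bit_graph by (rule models_PA_over_fn_update)
  interpret M': pa_model ?M
    using PA_over by unfold_locales (simp add: PA_def)
  have nm: "M'.nm n = nm n" for n
    by (induction n) simp_all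
  \<comment> \<open>The interpretation defines the arithmetical notions anew for the expanded model.
    Their formulas lack \<open>f\<close>, so they agree with the old ones.\<close>
  have less: "M'.less x y \<longleftrightarrow> x \<sqsubset> y" for x y
    using sat_fn_update[of "Var 0 \<^bold>< Var 1" bit M "case_nat x (\<lambda>_. y)"] by simp
  have len: "M'.len x y \<longleftrightarrow> len x y" for x y
    using sat_fn_update[of "Len (Var 0) (Var 1)" bit M "case_nat x (\<lambda>_. y)"] by simp
  have pre: "M'.pre x y \<longleftrightarrow> pre x y" for x y
    using sat_fn_update[of "Prefix (Var 0) (Var 1)" bit M "case_nat x (\<lambda>_. y)"] by simp
  have kge: "M'.kge U c x y \<longleftrightarrow> kge U c x y" for x y
    using sat_fn_update[of "K_ge U c (Var 0) (Var 1)" bit M "case_nat x (\<lambda>_. y)"] arithmetical_U by simp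
  have "M'.restr n (least n)" for n
  proof -
    have "\<exists>q. len q i \<and> pre (q \<oplus> q \<oplus> bit i) (least n)" if "i \<sqsubset> n" for i
      using len_least[of i] pre_least[OF that[unfolded less_def]] least_suc_eq[of i "bit i"] by auto
    then show ?thesis using len_least by (simp add: M'.restr_def len pre less)
  qed
  then have "sat ?M e (random_axiom U c)" for e
    using bit_cases good_kge[OF good_least] by (auto simp: M'.sat_random_axiom kge)
  moreover have "sat ?M e (Fn (num i) \<^bold>= num (of_bool (X i)))" if "i < length u" for i e
    using bit_initial_segment[OF assms that] by (simp add: nm)
  ultimately show ?thesis using PA_over unfolding models_def by blast
qed

end

section \<open>Compactness and transfer to provability\<close>

lemma provable_mono: "provable L T \<phi> \<Longrightarrow> T \<subseteq> T' \<Longrightarrow> provable L T' \<phi>"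
  by (induction rule: provable.induct) (auto intro: provable.intros)

lemma provable_compact:
  assumes "provable L (\<Union>n::nat. S n) \<phi>" "incseq S"
  shows "\<exists>n. provable L (S n) \<phi>"
  using assms(1)
proof (induction rule: provable.induct)
  case (modus_ponens \<phi> \<psi>)
  then obtain m n where "provable L (S m) (\<phi> \<^bold>\<longrightarrow> \<psi>)" "provable L (S n) \<phi>" by blast
  moreover have "S m \<subseteq> S (max m n)" "S n \<subseteq> S (max m n)"
    using assms(2) by (simp_all add: monoD)
  ultimately show ?case by (blast intro: provable_mono provable.modus_ponens)
qed (auto intro: provable.intros)

text \<open>The interpretation of \<open>f\<close> is chosen after \<open>n\<close>, and only its
  first \<open>n\<close> bits are tied to \<open>X\<close>.\<close>

lemma models_MLR''_expansion:
  assumes "arithmetical U" "models M (MLR'' U c X)"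
  shows "\<exists>g. models (M\<lparr>fn_in := g\<rparr>) (PA_over L \<union> {random_axiom U c} \<union>
    {Fn (num i) \<^bold>= num (of_bool (X i)) | i. i < n})"
proof -
  interpret pa_model M using assms(2) by unfold_locales (auto simp: models_def MLR''_def)
  let ?u = "initial_segment X n"
  have "sat M undefined (Ext U c ?u)" using assms(2) by (auto simp: models_def MLR''_def)
  then have ext: "\<exists>v. len v m \<and> pre (nm (code ?u)) v \<and> fine U c v" if "nm n \<sqsubseteq> m" for m
    using that by (simp add: sat_Ext)
  interpret ext_model M U c ?u
  proof
    show "\<exists>p. exp2 k p" for k
      using ext[of "k \<oplus> nm n"] by (intro exp2_pred[of k n]) (auto simp: len_def le_def add_commute)
  qed (use assms(1) ext in auto)
  show ?thesis using models_bit[of X L, unfolded length_initial_segment] by blast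
qed

lemma MLR'_imp_MLR'':
  assumes "arithmetical U" "arithmetical \<phi>" "provable L_PA_f (MLR' U c X) \<phi>"
  shows "provable L_PA (MLR'' U c X) \<phi>"
proof -
  define S where "S n = PA_over L_PA_f \<union> {random_axiom U c} \<union>
    {Fn (num i) \<^bold>= num (of_bool (X i)) | i. i < n}" for n
  have "MLR' U c X = (\<Union>n. S n)" unfolding MLR'_def S_def by blast
  moreover have "incseq S" unfolding S_def mono_def by fastforce
  ultimately obtain n where n: "provable L_PA_f (S n) \<phi>"
    using assms(3) provable_compact by metis
  have L_PA: "L_PA = lang False" by (simp add: L_PA_def lang_def)
  have "PA \<subseteq> L_PA"
  proof
    have "arithmetical (induction_axiom \<psi>)" if "arithmetical \<psi>" for \<psi>
      using that by (simp add: induction_axiom_def inst_def arithmetical_subst split: nat.split)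
    then show "\<psi> \<in> L_PA" if "\<psi> \<in> PA" for \<psi>
      using that by (auto simp: PA_def PA_over_def L_PA_def)
  qed
  then interpret calculus False "MLR'' U c X"
    using assms(1) arithmetical_Ext
    by unfold_locales (auto simp: MLR''_def PA_def PA_over_def L_PA[symmetric] L_PA_def)
  show ?thesis
    unfolding L_PA
  proof (rule completeness)
    show "\<phi> \<in> lang False" using assms(2) by (simp add: lang_def)
  next
    fix M :: "nat struct" and e
    assume M: "models M (MLR'' U c X)"
    then obtain g where "models (M\<lparr>fn_in := g\<rparr>) (S n)"
      using models_MLR''_expansion[OF assms(1)] unfolding S_def by blast
    then have "sat (M\<lparr>fn_in := g\<rparr>) e \<phi>" using n by (intro soundness)
    then show "sat M e \<phi>" using assms(2) by (simp add: sat_fn_update)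
  qed
qed

text \<open>\<open>soundness\<close> is indifferent to the language of a derivation, so one in
  \<open>L_PA\<close> can be evaluated in models with \<open>f\<close>. Completeness for the larger
  language then spares a formal derivation of the \<open>Ext\<close> axioms.\<close>

lemma MLR''_imp_MLR':
  assumes "provable L_PA (MLR'' U c X) \<phi>"
  shows "provable L_PA_f (MLR' U c X) \<phi>"
proof -
  have L: "L_PA_f = lang True" by (simp add: L_PA_f_def lang_def)
  interpret calculus True "MLR' U c X"
    by unfold_locales (auto simp: MLR'_def PA_over_def lang_def)
  show ?thesis unfolding L
  proof (rule completeness)
    show "\<phi> \<in> lang True" by (simp add: lang_def)
  next
    fix M :: "nat struct" and e
    assume "models M (MLR' U c X)"
    then show "sat M e \<phi>" using assms models_MLR'_imp_MLR'' by (intro soundness)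
  qed
qed

theorem theorem16:
  fixes U :: fm and c :: nat and X :: "nat \<Rightarrow> bool"
  assumes "natural_representation U"
  shows "\<forall>\<phi>. arithmetical \<phi> \<longrightarrow>
    (provable L_PA_f (MLR' U c X) \<phi> \<longleftrightarrow> provable L_PA (MLR'' U c X) \<phi>)"
proof -
  have "arithmetical U"
    using assms by (simp add: natural_representation_def sigma1_machine_def)
  then show ?thesis using MLR'_imp_MLR'' MLR''_imp_MLR' by blast
qed

end
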